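(* Let $X$ be a Banach space, $f:X\to\mathbb{R}\cup\{+\infty\}$ lower semicontinuous and $\bar x\in[f\le0]$. Let $\tau>0$, $\delta\in(0,\infty]$ and $q\in(0,1]$. Suppose that either $X$ is Asplund or $f$ is convex, and $$d(x,[f\le0])^{q-1}\, d(0,\partial f(x))^q\ge\tau\quad\text{for all } x\in B_\delta(\bar x)\cap[f>0]\text{ with } f^q(x)<\tau\, d(x,[f\le0]).$$ Then $\alpha^q(1-\alpha)^{1-q}\tau\, d(x,[f\le0])\le f_+^q(x)$ for all $\alpha\in(0,1)$ and all $x\in B_{\delta/(1+\alpha)}(\bar x)$.
   Context: $[f\le0]=\{x: f(x)\le0\}$, $[f>0]=\{x:f(x)>0\}$, $f_+(x)=\max\{f(x),0\}$; for $f(x)\ge0$, $f^q(x):=[f(x)]^q$, $f_+^q(x)=[f_+(x)]^q$. $B_\delta(x)$ is the open ball of radius $\delta$ centered at $x$ ($B_\infty(x)=X$). $d(x,A)=\inf_{a\in A}\|x-a\|$, $d(x,\emptyset)=+\infty$. $\partial f(x)$ is the Fréchet subdifferential: $\{x^*\in X^*:\liminf_{y\to x}\frac{f(y)-f(x)-\langle x^*,y-x\rangle}{\|y-x\|}\ge0\}$ if $f(x)<+\infty$, $\emptyset$ otherwise (equal to the convex subdifferential for convex $f$); $d(0,\partial f(x))=\inf\{\|x^*\|:x^*\in\partial f(x)\}$ ($+\infty$ if empty). A Banach space is Asplund if every continuous convex function on an open convex subset is Fréchet differentiable on a dense subset. *)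

theory Defs
  imports "HOL-Analysis.Analysis"
begin

text \<open>Extended-real valued functions f : X -> R u {+oo} are modelled as maps into ereal
  that never take the value -oo.\<close>

definition lsc :: "('a::topological_space \<Rightarrow> ereal) \<Rightarrow> bool" where
  "lsc f \<longleftrightarrow> (\<forall>x. f x \<le> Liminf (at x) f)"

definition ext_convex :: "('a::real_vector \<Rightarrow> ereal) \<Rightarrow> bool" where
  "ext_convex f \<longleftrightarrow> (\<forall>x y t. 0 \<le> t \<and> t \<le> 1 \<longrightarrow>
      f ((1 - t) *\<^sub>R x + t *\<^sub>R y) \<le> ereal (1 - t) * f x + ereal t * f y)"

definition frechet_subdiff :: "('a::real_normed_vector \<Rightarrow> ereal) \<Rightarrow> 'a \<Rightarrow> ('a \<Rightarrow>\<^sub>L real) set" where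
  "frechet_subdiff f x =
     (if f x < \<infinity> then
        {x'. Liminf (at x) (\<lambda>y. (f y - f x - ereal (blinfun_apply x' (y - x))) / ereal (norm (y - x))) \<ge> 0}
      else {})"

text \<open>d(0, subdiff f x) = inf of dual norms, +oo if the subdifferential is empty.\<close>
definition dist_subdiff :: "('a::real_normed_vector \<Rightarrow> ereal) \<Rightarrow> 'a \<Rightarrow> ereal" where
  "dist_subdiff f x = (INF x' \<in> frechet_subdiff f x. ereal (norm x'))"

text \<open>d(x, A) = inf_{a in A} |x - a|, with d(x, {}) = +oo.\<close>
definition edist_set :: "'a::metric_space \<Rightarrow> 'a set \<Rightarrow> ereal" where
  "edist_set x A = (INF a \<in> A. ereal (dist x a))"

definition eball :: "'a::metric_space \<Rightarrow> ereal \<Rightarrow> 'a set" where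
  "eball c r = {x. ereal (dist c x) < r}"

text \<open>Power t^p of a nonnegative extended real t with real exponent p, with the usual
  conventions oo^p = oo (p>0), 0^p = oo (p<0), t^0 = 1.\<close>
definition epow :: "ereal \<Rightarrow> real \<Rightarrow> ereal" where
  "epow t p =
     (if p = 0 then 1
      else if t = \<infinity> then (if p > 0 then \<infinity> else 0)
      else if t = 0 then (if p > 0 then 0 else \<infinity>)
      else ereal (real_of_ereal t powr p))"

definition asplund :: "'a::real_normed_vector itself \<Rightarrow> bool" where
  "asplund _ \<longleftrightarrow> (\<forall>(U::'a set) (g::'a \<Rightarrow> real).
      open U \<and> convex U \<and> continuous_on U g \<and> convex_on U g \<longrightarrow>
      (\<exists>D \<subseteq> U. U \<subseteq> closure D \<and> (\<forall>x\<in>D. g differentiable (at x))))"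

end

theory Submission
  imports Defs
begin

text \<open>
  Suppose the estimate fails at \<open>x\<close>. A variational principle applied to \<open>f\<^sub>+\<close>, started at \<open>x\<close>,
  perturbs it by a series of Lipschitz functions \<open>W\<^sub>n (\<cdot> - x\<^sub>n)\<close> approximating multiples of the norm
  and yields an exact minimum near \<open>x\<close>. A Frechet subgradient there, of norm less than the slope
  allowed by the hypothesis, contradicts the slope condition. For convex \<open>f\<close> the \<open>W\<^sub>n\<close> are
  multiples of the norm, and the subgradient comes from the Hahn--Banach theorem.

  In an Asplund space the \<open>W\<^sub>n\<close> have to be smooth, which is possible along a closed separable
  subspace \<open>Y\<close>. Hahn--Banach turns the absence of a small subgradient into a point of a convex
  hull, so \<open>Y\<close> can be chosen such that subgradients along \<open>Y\<close> extend to the whole space. The dual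
  of \<open>Y\<close> is separable: otherwise there is an uncountable separated set of functionals on \<open>Y\<close> none
  of whose nonempty slices is a singleton, and a minimal sublinear functional on the whole space
  dominating it on \<open>Y\<close> is nowhere Frechet differentiable. With a sequence \<open>d\<^sub>n\<close> dense in the dual
  ball of \<open>Y\<close>, the norm is uniformly approximated by functions \<open>z \<mapsto> sup\<^sub>u (u z - \<Phi> u)\<close>, where \<open>\<Phi>\<close>
  is a small weighted sum of the squared distances to the \<open>d\<^sub>n\<close> and of squared evaluations.
\<close>

section \<open>Sublinear functionals and the Hahn--Banach theorem\<close>

definition sublinear :: "('a::real_vector \<Rightarrow> real) \<Rightarrow> bool" where
  "sublinear p \<longleftrightarrow> (\<forall>x y. p (x + y) \<le> p x + p y) \<and> (\<forall>t x. 0 \<le> t \<longrightarrow> p (t *\<^sub>R x) = t * p x)"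

lemma sublinear_add: "sublinear p \<Longrightarrow> p (x + y) \<le> p x + p y"
  by (simp add: sublinear_def)

lemma sublinear_scaleR: "sublinear p \<Longrightarrow> 0 \<le> t \<Longrightarrow> p (t *\<^sub>R x) = t * p x"
  by (simp add: sublinear_def)

lemma sublinear_0: "sublinear p \<Longrightarrow> p 0 = 0"
  using sublinear_scaleR[of p 0 0] by simp

lemma sublinear_minus_ge: "sublinear p \<Longrightarrow> - p x \<le> p (- x)"
  using sublinear_add[of p x "- x"] sublinear_0[of p] by simp

lemma sublinearI:
  assumes add: "\<And>x y. p (x + y) \<le> p x + p y"
    and scale: "\<And>t x. 0 < t \<Longrightarrow> p (t *\<^sub>R x) \<le> t * p x" and zero: "p 0 = 0"
  shows "sublinear p"
proof -
  have "p (t *\<^sub>R x) = t * p x" if "0 \<le> t" for t x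
  proof (cases "t = 0")
    case False
    then have t: "0 < t" using that by simp
    have "p (inverse t *\<^sub>R (t *\<^sub>R x)) \<le> inverse t * p (t *\<^sub>R x)"
      using t by (intro scale) simp
    then have "t * p x \<le> p (t *\<^sub>R x)"
      using t by (simp add: field_simps)
    with scale[OF t, of x] show ?thesis by simp
  qed (simp add: zero)
  then show ?thesis
    using add unfolding sublinear_def by blast
qed

lemma sublinear_norm: "0 \<le> c \<Longrightarrow> sublinear (\<lambda>x::'a::real_normed_vector. c * norm x)"
  by (rule sublinearI) (auto simp: norm_triangle_ineq mult_left_mono simp flip: distrib_left)

lemma sublinear_imp_convex_on: "sublinear p \<Longrightarrow> convex_on UNIV p"
  by (rule convex_onI) (auto simp flip: sublinear_scaleR intro: sublinear_add)

lemma sublinear_INF: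
  fixes g :: "'i \<Rightarrow> 'a::real_vector \<Rightarrow> real"
  assumes bdd: "\<And>x. bdd_below ((\<lambda>i. g i x) ` I)"
    and add: "\<And>i j x y. i \<in> I \<Longrightarrow> j \<in> I \<Longrightarrow> \<exists>k\<in>I. g k (x + y) \<le> g i x + g j y"
    and scale: "\<And>i t x. i \<in> I \<Longrightarrow> 0 < t \<Longrightarrow> \<exists>k\<in>I. g k (t *\<^sub>R x) \<le> t * g i x"
    and zero: "i0 \<in> I" "g i0 0 \<le> 0" "\<And>i. i \<in> I \<Longrightarrow> 0 \<le> g i 0"
  shows "sublinear (\<lambda>x. INF i\<in>I. g i x)"
proof (rule sublinearI)
  let ?p = "\<lambda>x. INF i\<in>I. g i x"
  have ne: "I \<noteq> {}" using zero(1) by blast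
  have lower: "?p x \<le> g i x" if "i \<in> I" for i x
    using that by (rule cINF_lower[OF bdd])
  show "?p (x + y) \<le> ?p x + ?p y" for x y
  proof -
    have "?p (x + y) - g i x \<le> ?p y" if i: "i \<in> I" for i
    proof (rule cINF_greatest[OF ne])
      fix j assume "j \<in> I"
      then obtain k where "k \<in> I" "g k (x + y) \<le> g i x + g j y" using add[OF i] by blast
      then show "?p (x + y) - g i x \<le> g j y" using lower[of k "x + y"] by linarith
    qed
    then have "?p (x + y) - ?p y \<le> ?p x" by (intro cINF_greatest[OF ne]) (simp add: algebra_simps)
    then show ?thesis by simp
  qed
  show "?p (t *\<^sub>R x) \<le> t * ?p x" if t: "0 < t" for t x
  proof -
    have "?p (t *\<^sub>R x) / t \<le> ?p x"
    proof (rule cINF_greatest[OF ne])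
      fix i assume "i \<in> I"
      then obtain k where "k \<in> I" "g k (t *\<^sub>R x) \<le> t * g i x" using scale t by blast
      then have "?p (t *\<^sub>R x) \<le> t * g i x" using lower[of k "t *\<^sub>R x"] by linarith
      then show "?p (t *\<^sub>R x) / t \<le> g i x" using t by (simp add: field_simps)
    qed
    then show ?thesis using t by (simp add: field_simps)
  qed
  show "?p 0 = 0"
    using order.trans[OF lower[OF zero(1)] zero(2)] cINF_greatest[OF ne zero(3)] by (rule antisym)
qed

lemma sublinear_SUP_linear:
  assumes "U \<noteq> {}" and lin: "\<And>u. u \<in> U \<Longrightarrow> linear u" and bdd: "\<And>x. bdd_above ((\<lambda>u. u x) ` U)"
  shows "sublinear (\<lambda>x::'a::real_vector. SUP u\<in>U. u x :: real)"
proof (rule sublinearI)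
  have upper: "u x \<le> (SUP u\<in>U. u x)" if "u \<in> U" for u x
    by (rule cSUP_upper[OF that bdd])
  show "(SUP u\<in>U. u (x + y)) \<le> (SUP u\<in>U. u x) + (SUP u\<in>U. u y)" for x y
    using upper by (intro cSUP_least assms(1)) (auto simp: linear_add[OF lin] intro: add_mono)
  show "(SUP u\<in>U. u (t *\<^sub>R x)) \<le> t * (SUP u\<in>U. u x)" if "0 < t" for t x
    using upper that
    by (intro cSUP_least assms(1)) (auto simp: linear_scale[OF lin] intro: mult_left_mono)
  have "(\<lambda>u. u 0) ` U = {0}" using assms(1) linear_0[OF lin] by force
  then show "(SUP u\<in>U. u 0) = 0" by simp
qed

definition sublinear_majorants :: "'a::real_vector set \<Rightarrow> ('a \<Rightarrow> real) \<Rightarrow> ('a \<Rightarrow> real) set" where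
  "sublinear_majorants Y g = {q. sublinear q \<and> (\<forall>y\<in>Y. g y \<le> q y)}"

lemma sublinear_majorant_INF_chain:
  assumes C: "C \<noteq> {}" "C \<subseteq> sublinear_majorants Y g"
    and chain: "\<forall>q\<in>C. \<forall>r\<in>C. q \<le> r \<or> r \<le> q" and le: "\<forall>q\<in>C. q \<le> p"
  shows "(\<lambda>x. INF q\<in>C. q x) \<in> sublinear_majorants Y g" and "q \<in> C \<Longrightarrow> (\<lambda>x. INF q\<in>C. q x) \<le> q"
proof -
  have sub: "sublinear q" if "q \<in> C" for q
    using C(2) that by (auto simp: sublinear_majorants_def)
  have bdd: "bdd_below ((\<lambda>q. q x) ` C)" for x
  proof (rule bdd_belowI2)
    show "- p (- x) \<le> q x" if "q \<in> C" for q
      using sublinear_minus_ge[OF sub[OF that], of "- x"] le_funD[OF bspec[OF le that], of "- x"]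
      by simp
  qed
  obtain q0 where q0: "q0 \<in> C" using C(1) by blast
  have "sublinear (\<lambda>x. INF q\<in>C. q x)"
  proof (rule sublinear_INF[OF bdd _ _ q0])
    fix q r x y assume qr: "q \<in> C" "r \<in> C"
    then obtain s where s: "s \<in> C" "s \<le> q" "s \<le> r" using chain by blast
    have "s (x + y) \<le> q x + r y"
      using sublinear_add[OF sub[OF s(1)], of x y] le_funD[OF s(2), of x] le_funD[OF s(3), of y]
      by linarith
    then show "\<exists>s\<in>C. s (x + y) \<le> q x + r y" using s(1) by blast
  next
    show "\<exists>s\<in>C. s (t *\<^sub>R x) \<le> t * q x" if "q \<in> C" "0 < t" for q t x
      using sublinear_scaleR[OF sub[OF that(1)], of t x] that by (intro bexI[of _ q]) auto
  qed (simp_all add: sublinear_0[OF sub] q0)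
  moreover have "g y \<le> (INF q\<in>C. q y)" if "y \<in> Y" for y
    using C that by (intro cINF_greatest) (auto simp: sublinear_majorants_def)
  ultimately show "(\<lambda>x. INF q\<in>C. q x) \<in> sublinear_majorants Y g"
    by (simp add: sublinear_majorants_def)
  show "q \<in> C \<Longrightarrow> (\<lambda>x. INF q\<in>C. q x) \<le> q"
    by (rule le_funI) (rule cINF_lower[OF bdd])
qed

lemma minimal_sublinear_majorant:
  assumes p: "p \<in> sublinear_majorants Y g"
  obtains q where "q \<in> sublinear_majorants Y g" "q \<le> p"
    "\<forall>r\<in>sublinear_majorants Y g. r \<le> q \<longrightarrow> r = q"
proof -
  define A where "A = {q \<in> sublinear_majorants Y g. q \<le> p}"
  have "\<exists>m\<in>A. \<forall>a\<in>A. a \<le> m \<longrightarrow> a = m"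
  proof (rule predicate_Zorn)
    show "partial_order_on A (relation_of (\<lambda>q r. r \<le> q) A)"
      by (rule partial_order_on_relation_ofI) auto
  next
    fix C assume C: "C \<in> Chains (relation_of (\<lambda>q r. r \<le> q) A)"
    show "\<exists>u\<in>A. \<forall>a\<in>C. u \<le> a"
    proof (cases "C = {}")
      case False
      then obtain q where q: "q \<in> C" by blast
      have CA: "C \<subseteq> A" and chain: "\<forall>q\<in>C. \<forall>r\<in>C. q \<le> r \<or> r \<le> q"
        using C by (auto simp: Chains_def relation_of_def)
      have "C \<subseteq> sublinear_majorants Y g" and le: "\<forall>q\<in>C. q \<le> p"
        using CA by (auto simp: A_def)
      note INF = sublinear_majorant_INF_chain[OF False this(1) chain le]
      have "(\<lambda>x. INF q\<in>C. q x) \<in> A"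
        using INF(1) order.trans[OF INF(2)[OF q]] q CA by (auto simp: A_def)
      then show ?thesis using INF(2) by blast
    qed (use p in \<open>auto simp: A_def\<close>)
  qed
  then show thesis
    by (auto simp: A_def intro!: that intro: order.trans)
qed

text \<open>Infimal convolution of \<open>p\<close> with the function \<open>h \<mapsto> inf {s. (h, s) \<in> K}\<close>.\<close>

definition inf_conv :: "('a::real_vector \<Rightarrow> real) \<Rightarrow> ('a \<times> real) set \<Rightarrow> 'a \<Rightarrow> real" where
  "inf_conv p K x = (INF (h, s)\<in>K. s + p (x - h))"

context
  fixes p :: "'a::real_vector \<Rightarrow> real" and K :: "('a \<times> real) set"
  assumes p: "sublinear p" and K: "convex_cone K" and nonneg: "\<And>h s. (h, s) \<in> K \<Longrightarrow> 0 \<le> s + p (- h)"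
begin

lemma inf_conv_bdd_below: "bdd_below ((\<lambda>(h, s). s + p (x - h)) ` K)"
proof (rule bdd_belowI2, clarify)
  fix h s assume "(h, s) \<in> K"
  from nonneg[OF this] sublinear_add[OF p, of "x - h" "- x"]
  show "- p (- x) \<le> s + p (x - h)" by simp
qed

lemma inf_conv_le: "(h, s) \<in> K \<Longrightarrow> inf_conv p K x \<le> s + p (x - h)"
  using cINF_lower[OF inf_conv_bdd_below, of "(h, s)" x] by (simp add: inf_conv_def)

lemma inf_conv_le_self: "inf_conv p K x \<le> p x"
  using inf_conv_le[of 0 0 x] convex_cone_contains_0[OF K] by (simp add: zero_prod_def)

lemma sublinear_inf_conv: "sublinear (inf_conv p K)"
  unfolding inf_conv_def[abs_def]
proof (rule sublinear_INF[OF inf_conv_bdd_below])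
  fix k l x y assume kl: "k \<in> K" "l \<in> K"
  have "p (x + y - fst (k + l)) \<le> p (x - fst k) + p (y - fst l)"
    using sublinear_add[OF p, of "x - fst k" "y - fst l"] by (simp add: algebra_simps)
  then show "\<exists>m\<in>K. (case m of (h, s) \<Rightarrow> s + p (x + y - h)) \<le>
      (case k of (h, s) \<Rightarrow> s + p (x - h)) + (case l of (h, s) \<Rightarrow> s + p (y - h))"
    using convex_cone_add[OF K kl] by (intro bexI[of _ "k + l"]) (auto simp: case_prod_beta)
next
  fix k x and t :: real assume k: "k \<in> K" and t: "0 < t"
  have "p (t *\<^sub>R x - fst (t *\<^sub>R k)) = t * p (x - fst k)"
    using sublinear_scaleR[OF p, of t "x - fst k"] t by (simp add: scaleR_diff_right)
  then show "\<exists>m\<in>K. (case m of (h, s) \<Rightarrow> s + p (t *\<^sub>R x - h)) \<le> t * (case k of (h, s) \<Rightarrow> s + p (x - h))"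
    using convex_cone_scaleR[OF K _ k, of t] t
    by (intro bexI[of _ "t *\<^sub>R k"]) (auto simp: case_prod_beta distrib_left)
qed (use convex_cone_contains_0[OF K] nonneg sublinear_0[OF p] in \<open>auto simp: zero_prod_def\<close>)

end

lemma sublinear_linear_minorant:
  fixes p :: "'a::real_vector \<Rightarrow> real"
  assumes "sublinear p"
  obtains L where "linear L" "L \<le> p"
proof -
  obtain q where q: "sublinear q" "q \<le> p" and min: "\<And>r. sublinear r \<Longrightarrow> r \<le> q \<Longrightarrow> r = q"
    using minimal_sublinear_majorant[of p "{}" "\<lambda>_. 0"] assms
    by (auto simp: sublinear_majorants_def)
  have superadd: "q x + q v \<le> q (x + v)" for x v
  proof -
    define K where "K = (\<lambda>t. t *\<^sub>R (- v, - q v)) ` {0..}"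
    have "convex_cone ({0..} :: real set)" by (simp add: convex_cone_iff)
    then have K: "convex_cone K"
      unfolding K_def by (intro convex_cone_linear_image conjI linear_scaleR_left)
    have nonneg: "0 \<le> s + q (- h)" if "(h, s) \<in> K" for h s
      using that sublinear_scaleR[OF q(1)] by (auto simp: K_def)
    have "inf_conv q K = q"
      using inf_conv_le_self[OF q(1) K nonneg]
      by (intro min sublinear_inf_conv[OF q(1) K nonneg]) (auto simp: le_fun_def)
    moreover have "(- v, - q v) \<in> K" unfolding K_def by (rule image_eqI[of _ _ 1]) auto
    ultimately show ?thesis using inf_conv_le[OF q(1) K nonneg, of "- v" "- q v" x] by simp
  qed
  have add: "q (x + y) = q x + q y" for x y
    using superadd[of x y] sublinear_add[OF q(1), of x y] by simp
  have minus: "q (- x) = - q x" for x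
    using add[of x "- x"] sublinear_0[OF q(1)] by simp
  have "q (t *\<^sub>R x) = t *\<^sub>R q x" for t x
    using sublinear_scaleR[OF q(1), of t x] sublinear_scaleR[OF q(1), of "- t" x] minus[of "t *\<^sub>R x"]
    by (cases "0 \<le> t") auto
  with add have "linear q" by (intro linearI)
  then show thesis using q(2) by (rule that)
qed

lemma hahn_banach_convex_cone:
  fixes p :: "'a::real_vector \<Rightarrow> real"
  assumes p: "sublinear p" and K: "convex_cone K" and nonneg: "\<And>h s. (h, s) \<in> K \<Longrightarrow> 0 \<le> s + p (- h)"
  obtains L where "linear L" "L \<le> p" "\<And>h s. (h, s) \<in> K \<Longrightarrow> L h \<le> s"
proof -
  obtain L where L: "linear L" "L \<le> inf_conv p K"
    using sublinear_linear_minorant[OF sublinear_inf_conv[OF p K nonneg]] by blast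
  show thesis
  proof (rule that[OF L(1)])
    show "L \<le> p"
      using L(2) inf_conv_le_self[OF p K nonneg] by (auto simp: le_fun_def intro: order.trans)
    show "L h \<le> s" if "(h, s) \<in> K" for h s
      using le_funD[OF L(2), of h] inf_conv_le[OF p K nonneg that, of h] sublinear_0[OF p] by simp
  qed
qed

lemma hahn_banach_dominated:
  fixes p :: "'a::real_vector \<Rightarrow> real"
  assumes p: "sublinear p" and Y: "subspace Y"
    and add: "\<And>x y. x \<in> Y \<Longrightarrow> y \<in> Y \<Longrightarrow> g (x + y) = g x + g y"
    and scale: "\<And>t x. x \<in> Y \<Longrightarrow> g (t *\<^sub>R x) = t * g x"
    and le: "\<And>y. y \<in> Y \<Longrightarrow> g y \<le> p y"
  obtains L where "linear L" "L \<le> p" "\<And>y. y \<in> Y \<Longrightarrow> L y = g y"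
proof -
  define K where "K = (\<lambda>y. (y, g y)) ` Y"
  have minus: "g (- y) = - g y" if "y \<in> Y" for y using scale[OF that, of "- 1"] by simp
  have "subspace K"
    unfolding subspace_def
      using scale[of 0 0] add scale subspace_0[OF Y] subspace_add[OF Y] subspace_scale[OF Y]
    by (auto simp: K_def image_iff zero_prod_def)
  then have "convex_cone K" by (rule subspace_imp_convex_cone)
  moreover have "0 \<le> s + p (- h)" if "(h, s) \<in> K" for h s
    using that le[of "- h"] minus subspace_neg[OF Y] by (auto simp: K_def)
  ultimately obtain L where L: "linear L" "L \<le> p" "\<And>h s. (h, s) \<in> K \<Longrightarrow> L h \<le> s"
    using hahn_banach_convex_cone[OF p] by blast
  have "L y \<le> g y" if "y \<in> Y" for y using L(3) that by (simp add: K_def)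
  then have "L y = g y" if "y \<in> Y" for y
    using that subspace_neg[OF Y that] minus[OF that] linear_neg[OF L(1), of y]
    by (metis antisym neg_le_iff_le)
  with L(1,2) show thesis by (rule that)
qed

lemma linear_bounded_imp_blinfun:
  fixes L :: "'a::real_normed_vector \<Rightarrow> real"
  assumes L: "linear L" and le: "\<And>x. L x \<le> c * norm x" and c: "0 \<le> c"
  obtains l :: "'a \<Rightarrow>\<^sub>L real" where "norm l \<le> c" "\<And>x. l x = L x"
proof -
  have bound: "norm (L x) \<le> norm x * c" for x
    using le[of x] le[of "- x"] linear_neg[OF L, of x] by (simp add: abs_le_iff mult.commute)
  then have "bounded_linear L"
    using L by (intro bounded_linear_intro[of L c]) (auto simp: linear_add linear_scale)
  then have apply_eq: "Blinfun L x = L x" for x by (simp add: bounded_linear_Blinfun_apply)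
  show thesis
  proof (rule that)
    show "norm (Blinfun L) \<le> c"
      using bound by (intro norm_blinfun_bound c) (simp add: apply_eq mult.commute)
  qed (rule apply_eq)
qed

lemma abs_blinfun_le: "norm l \<le> c \<Longrightarrow> \<bar>blinfun_apply l x\<bar> \<le> c * norm x"
  for l :: "'a::real_normed_vector \<Rightarrow>\<^sub>L real"
  using norm_blinfun[of l x] mult_right_mono[of "norm l" c "norm x"] by simp

lemma hahn_banach_convex:
  fixes E :: "('a::real_normed_vector \<times> real) set"
  assumes E: "convex E" and c: "0 \<le> c" and nonneg: "\<And>h s. (h, s) \<in> E \<Longrightarrow> 0 \<le> s + c * norm h"
  obtains x' :: "'a \<Rightarrow>\<^sub>L real" where "norm x' \<le> c" "\<And>h s. (h, s) \<in> E \<Longrightarrow> x' h \<le> s"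
proof (cases "E = {}")
  case False
  define K where "K = convex_cone hull E"
  have K_eq: "K = (\<Union>e\<in>E. \<Union>t\<in>{0..}. {t *\<^sub>R e})"
    using convex_cone_hull_convex_hull_nonempty[OF False] hull_same[of convex E] E
    by (simp add: K_def)
  have nonneg_K: "0 \<le> s + c * norm (- h)" if "(h, s) \<in> K" for h s
  proof -
    obtain t h' s' where "0 \<le> t" "(h', s') \<in> E" "h = t *\<^sub>R h'" "s = t * s'"
      using \<open>(h, s) \<in> K\<close> by (auto simp: K_eq)
    then have "s + c * norm (- h) = t * (s' + c * norm h')" "0 \<le> s' + c * norm h'"
      using nonneg by (auto simp: algebra_simps)
    then show ?thesis using \<open>0 \<le> t\<close> by simp
  qed
  obtain L where L: "linear L" "L \<le> (\<lambda>x. c * norm x)" "\<And>h s. (h, s) \<in> K \<Longrightarrow> L h \<le> s"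
    using hahn_banach_convex_cone[OF sublinear_norm[OF c] _ nonneg_K] convex_cone_convex_cone_hull
    unfolding K_def by blast
  obtain x' :: "'a \<Rightarrow>\<^sub>L real" where x': "norm x' \<le> c" "\<And>x. x' x = L x"
    using linear_bounded_imp_blinfun[OF L(1) le_funD[OF L(2)] c] by blast
  show thesis
    using L(3) hull_inc[of _ E convex_cone] by (intro that[OF x'(1)]) (auto simp: x'(2) K_def)
next
  case True
  then show thesis using c by (intro that[of 0]) auto
qed

lemma norming_functional:
  fixes z :: "'a::real_normed_vector"
  assumes "0 \<le> c"
  obtains u :: "'a \<Rightarrow>\<^sub>L real" where "norm u \<le> c" "u z = c * norm z"
proof -
  obtain u :: "'a \<Rightarrow>\<^sub>L real" where u: "norm u \<le> c" "u (- z) \<le> - (c * norm z)"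
    using hahn_banach_convex[OF convex_singleton assms, of "(- z, - (c * norm z))"] by auto
  then have "u z = c * norm z" using abs_blinfun_le[OF u(1), of z]
    by (simp add: blinfun.minus_right)
  with u(1) show thesis by (rule that)
qed

section \<open>Separable subspaces of Asplund spaces\<close>

text \<open>The dual norm of the restriction of \<open>u\<close> to \<open>Z\<close>; the term for \<open>z = 0\<close> is \<open>0\<close>.\<close>

definition norm_on :: "'a::real_normed_vector set \<Rightarrow> ('a \<Rightarrow>\<^sub>L real) \<Rightarrow> real" where
  "norm_on Z u = (SUP z\<in>Z. \<bar>blinfun_apply u z\<bar> / norm z)"

lemma norm_on_least:
  assumes "Z \<noteq> {}" "0 \<le> K" "\<And>z. z \<in> Z \<Longrightarrow> \<bar>blinfun_apply u z\<bar> \<le> K * norm z"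
  shows "norm_on Z u \<le> K"
  unfolding norm_on_def
proof (rule cSUP_least[OF assms(1)])
  show "\<bar>blinfun_apply u z\<bar> / norm z \<le> K" if "z \<in> Z" for z
    using assms(2) assms(3)[OF that] by (cases "z = 0") (simp_all add: divide_le_eq)
qed

lemma norm_on_upper: "z \<in> Z \<Longrightarrow> \<bar>blinfun_apply u z\<bar> / norm z \<le> norm_on Z u"
  unfolding norm_on_def
proof (rule cSUP_upper)
  show "bdd_above ((\<lambda>z. \<bar>blinfun_apply u z\<bar> / norm z) ` Z)"
  proof (rule bdd_aboveI2)
    show "\<bar>blinfun_apply u z\<bar> / norm z \<le> norm u" for z
      using abs_blinfun_le[OF order.refl, of u z] by (cases "z = 0") (simp_all add: divide_le_eq)
  qed
qed

lemma abs_blinfun_le_norm_on: "z \<in> Z \<Longrightarrow> \<bar>blinfun_apply u z\<bar> \<le> norm_on Z u * norm z"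
  using norm_on_upper[of z Z u] by (cases "z = 0") (simp_all add: divide_le_eq)

lemma norm_on_nonneg: "Z \<noteq> {} \<Longrightarrow> 0 \<le> norm_on Z u"
  using norm_on_upper[of _ Z u]
  by (metis abs_ge_zero divide_nonneg_nonneg ex_in_conv norm_ge_zero order.trans)

lemma norm_on_le_norm: "Z \<noteq> {} \<Longrightarrow> norm_on Z u \<le> norm u"
  by (rule norm_on_least) (auto intro: abs_blinfun_le)

lemma norm_on_minus_commute: "norm_on Z (u - w) = norm_on Z (w - u)"
  by (simp add: norm_on_def blinfun.diff_left abs_minus_commute)

lemma sublinear_norm_on:
  assumes Z: "Z \<noteq> {}"
  shows "sublinear (norm_on Z)"
proof (rule sublinearI)
  fix u w :: "'a \<Rightarrow>\<^sub>L real" and t :: real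
  show "norm_on Z (u + w) \<le> norm_on Z u + norm_on Z w"
  proof (rule norm_on_least[OF Z])
    fix z assume "z \<in> Z"
    from abs_blinfun_le_norm_on[OF this, of u] abs_blinfun_le_norm_on[OF this, of w]
    show "\<bar>blinfun_apply (u + w) z\<bar> \<le> (norm_on Z u + norm_on Z w) * norm z"
      by (simp add: blinfun.add_left distrib_right)
  qed (simp add: norm_on_nonneg[OF Z])
  show "norm_on Z (t *\<^sub>R u) \<le> t * norm_on Z u" if "0 < t"
  proof (rule norm_on_least[OF Z])
    show "\<bar>blinfun_apply (t *\<^sub>R u) z\<bar> \<le> t * norm_on Z u * norm z" if "z \<in> Z" for z
      using abs_blinfun_le_norm_on[OF that, of u] \<open>0 < t\<close>
      by (simp add: blinfun.scaleR_left abs_mult mult.assoc)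
  qed (use that norm_on_nonneg[OF Z] in simp)
  show "norm_on Z 0 = 0"
    using norm_on_le_norm[OF Z, of 0] norm_on_nonneg[OF Z, of 0] by simp
qed

lemma sublinear_lipschitz_on:
  assumes q: "sublinear q" and le: "\<And>x. q x \<le> c * norm x" and c: "0 \<le> c"
  shows "c-lipschitz_on UNIV q"
proof (rule lipschitz_onI[OF _ c])
  show "dist (q x) (q y) \<le> c * dist x y" for x y
    using sublinear_add[OF q, of "x - y" y] sublinear_add[OF q, of "y - x" x]
      le[of "x - y"] le[of "y - x"]
        by (simp add: dist_real_def dist_norm norm_minus_commute abs_le_iff)
qed

lemma asplund_sublinear_differentiable:
  fixes q :: "'a::real_normed_vector \<Rightarrow> real"
  assumes asplund: "asplund TYPE('a)" and q: "sublinear q" "\<And>x. q x \<le> c * norm x" and c: "0 \<le> c"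
  obtains x where "q differentiable (at x)"
proof -
  have "continuous_on UNIV q"
    by (rule lipschitz_on_continuous_on[OF sublinear_lipschitz_on[OF q c]])
  then obtain D where D: "UNIV \<subseteq> closure D" "\<forall>x\<in>D. q differentiable (at x)"
    using asplund sublinear_imp_convex_on[OF q(1)] unfolding asplund_def
    by (metis convex_UNIV open_UNIV)
  moreover from this have "D \<noteq> {}" by auto
  ultimately show thesis using that by blast
qed

lemma linear_abs_le_norm_if_sphere:
  fixes v :: "'a::real_normed_vector \<Rightarrow> real"
  assumes v: "linear v" and r: "0 < r" and sphere: "\<And>k. norm k = r \<Longrightarrow> v k \<le> B * r"
  shows "\<bar>v h\<bar> \<le> B * norm h"
proof (cases "h = 0")
  case False
  define s where "s = r / norm h"
  have s: "0 < s" "s * norm h = r" using False r by (simp_all add: s_def)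
  have "v (s *\<^sub>R h) \<le> B * r" "v (s *\<^sub>R (- h)) \<le> B * r"
    using s r by (intro sphere, simp)+
  then have "s * \<bar>v h\<bar> \<le> s * (B * norm h)"
    using s by (simp add: linear_scale[OF v] linear_neg[OF v] abs_if mult.left_commute[of s])
  then show ?thesis using s(1) by simp
qed (simp add: linear_0[OF v])

lemma linear_minorant_near_derivative:
  fixes q :: "'a::real_normed_vector \<Rightarrow> real"
  assumes D: "(q has_derivative D) (at x)" and e: "0 < e"
  obtains t where "0 < t"
    "\<And>u h. linear u \<Longrightarrow> u \<le> q \<Longrightarrow> q x - t < u x \<Longrightarrow> \<bar>u h - D h\<bar> \<le> e * norm h"
proof -
  obtain d where d: "0 < d"
    and deriv: "\<And>y. norm (y - x) < d \<Longrightarrow> norm (q y - q x - D (y - x)) \<le> e / 2 * norm (y - x)"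
    using D e unfolding has_derivative_at_alt by (meson half_gt_zero)
  define r where "r = d / 2"
  have r: "0 < r" "r < d" using d by (simp_all add: r_def)
  show thesis
  proof (rule that[of "e / 2 * r"])
    show "0 < e / 2 * r" using e r by simp
    fix u h assume u: "linear u" "u \<le> q" "q x - e / 2 * r < u x"
    show "\<bar>u h - D h\<bar> \<le> e * norm h"
    proof (rule linear_abs_le_norm_if_sphere[OF _ r(1)])
      show "linear (\<lambda>h. u h - D h)"
        using u(1) has_derivative_linear[OF D] by (rule linear_compose_sub)
      fix k :: 'a assume k: "norm k = r"
      have "u k = u (x + k) - u x" by (simp add: linear_add[OF u(1)])
      also have "\<dots> \<le> q (x + k) - q x + e / 2 * r" using le_funD[OF u(2), of "x + k"] u(3)
        by linarith
      also have "\<dots> \<le> D k + e / 2 * r + e / 2 * r"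
      proof -
        have "\<bar>q (x + k) - q x - D k\<bar> \<le> e / 2 * r" using deriv[of "x + k"] k r(2) by simp
        then show ?thesis by linarith
      qed
      finally show "u k - D k \<le> e * r" by simp
    qed
  qed
qed

lemma blinfun_extension_dominated:
  fixes a :: "'a::real_normed_vector \<Rightarrow>\<^sub>L real"
  assumes "sublinear q" "subspace Y" "\<And>y. y \<in> Y \<Longrightarrow> blinfun_apply a y \<le> q y"
  obtains L where "linear L" "L \<le> q" "\<forall>y\<in>Y. L y = blinfun_apply a y"
  by (rule hahn_banach_dominated[OF assms(1,2) blinfun.add_right _ assms(3)])
    (auto simp: blinfun.scaleR_right)

lemma minimal_sublinear_majorant_slice:
  fixes q :: "'a::real_vector \<Rightarrow> real"
  assumes q: "q \<in> sublinear_majorants Y g"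
    and min: "\<forall>r\<in>sublinear_majorants Y g. r \<le> q \<longrightarrow> r = q"
    and Y: "Y \<noteq> {}" and t: "0 < t"
  obtains y s where "y \<in> Y" "s < g y" "\<And>u. linear u \<Longrightarrow> u \<le> q \<Longrightarrow> s < u y \<Longrightarrow> q x - t < u x"
proof -
  define U where "U = {u. linear u \<and> u \<le> q \<and> u x \<le> q x - t}"
  show thesis
  proof (cases "U = {}")
    case True
    obtain y where "y \<in> Y" using Y by blast
    then show thesis using True by (intro that[of y "g y - 1"]) (auto simp: U_def not_less)
  next
    case False
    have bdd: "bdd_above ((\<lambda>u. u z) ` U)" for z
      by (rule bdd_aboveI2[of _ _ "q z"]) (auto simp: U_def le_fun_def)
    define r where "r z = (SUP u\<in>U. u z)" for z
    have r: "sublinear r"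
      unfolding r_def using False bdd by (intro sublinear_SUP_linear) (auto simp: U_def)
    have upper: "u z \<le> r z" if "u \<in> U" for u z
      unfolding r_def by (rule cSUP_upper[OF that bdd])
    have "r \<le> q" unfolding r_def by (intro le_funI cSUP_least False) (auto simp: U_def le_fun_def)
    moreover have "r x \<le> q x - t" unfolding r_def by (intro cSUP_least False) (auto simp: U_def)
    then have "r \<noteq> q" using t by auto
    ultimately have "r \<notin> sublinear_majorants Y g" using min by blast
    then obtain y where "y \<in> Y" "r y < g y" using r by (auto simp: sublinear_majorants_def not_le)
    then show thesis
      using upper[of _ y] by (intro that[of y "r y"]) (auto simp: U_def not_less[symmetric])
  qed
qed

lemma norm_on_diff_le:
  assumes "Z \<noteq> {}" "0 \<le> e" and a: "\<And>z. z \<in> Z \<Longrightarrow> \<bar>blinfun_apply a z - D z\<bar> \<le> e / 2 * norm z"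
    and b: "\<And>z. z \<in> Z \<Longrightarrow> \<bar>blinfun_apply b z - D z\<bar> \<le> e / 2 * norm z"
  shows "norm_on Z (a - b) \<le> e"
proof (rule norm_on_least[OF assms(1,2)])
  show "\<bar>blinfun_apply (a - b) z\<bar> \<le> e * norm z" if "z \<in> Z" for z
    using a[OF that] b[OF that] unfolding blinfun.diff_left by linarith
qed

text \<open>Slices by \<open>Y\<close> are slices at a point of Frechet differentiability of a minimal sublinear
  functional on the whole space that dominates \<open>A\<close> on \<open>Y\<close>.\<close>

lemma asplund_small_slice:
  fixes A :: "('a::real_normed_vector \<Rightarrow>\<^sub>L real) set"
  assumes asplund: "asplund TYPE('a)" and Y: "subspace Y" and A: "A \<noteq> {}" "A \<subseteq> cball 0 c"
    and e: "0 < e"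
  obtains y s a where "y \<in> Y" "a \<in> A" "s < blinfun_apply a y"
    "\<forall>a\<in>A. \<forall>b\<in>A. s < blinfun_apply a y \<longrightarrow> s < blinfun_apply b y \<longrightarrow> norm_on Y (a - b) \<le> e"
proof -
  have Y_ne: "Y \<noteq> {}" using subspace_0[OF Y] by blast
  have norm_le: "norm a \<le> c" if "a \<in> A" for a using A(2) that by auto
  then have c: "0 \<le> c" using A(1) by (metis ex_in_conv norm_ge_zero order.trans)
  have le: "blinfun_apply a y \<le> c * norm y" if "a \<in> A" for a y
    using abs_blinfun_le[OF norm_le[OF that], of y] by simp
  have bdd: "bdd_above ((\<lambda>a. blinfun_apply a y) ` A)" for y by (rule bdd_aboveI2) (rule le)
  define g where "g y = (SUP a\<in>A. blinfun_apply a y)" for y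
  have "(\<lambda>x. c * norm x) \<in> sublinear_majorants Y g"
    using sublinear_norm[OF c] cSUP_least[OF A(1) le] by (auto simp: sublinear_majorants_def g_def)
  then obtain q where q: "q \<in> sublinear_majorants Y g" "q \<le> (\<lambda>x. c * norm x)"
    and min: "\<forall>r\<in>sublinear_majorants Y g. r \<le> q \<longrightarrow> r = q"
    using minimal_sublinear_majorant by blast
  have sub: "sublinear q" and g_le: "\<And>y. y \<in> Y \<Longrightarrow> g y \<le> q y"
    using q(1) by (auto simp: sublinear_majorants_def)
  obtain x D where "(q has_derivative D) (at x)"
    using asplund_sublinear_differentiable[OF asplund sub le_funD[OF q(2)] c]
    unfolding differentiable_def by blast
  then obtain t where t: "0 < t"
    and near: "\<And>u h. linear u \<Longrightarrow> u \<le> q \<Longrightarrow> q x - t < u x \<Longrightarrow> \<bar>u h - D h\<bar> \<le> e / 2 * norm h"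
    by (rule linear_minorant_near_derivative[where e = "e / 2"]) (use e in auto)
  obtain y s where y: "y \<in> Y" "s < g y" and slice: "\<And>u. linear u \<Longrightarrow> u \<le> q \<Longrightarrow> s < u y \<Longrightarrow> q x - t < u x"
    by (rule minimal_sublinear_majorant_slice[OF q(1) min Y_ne t]) (rule that)
  have near_D: "\<bar>blinfun_apply a z - D z\<bar> \<le> e / 2 * norm z"
    if a: "a \<in> A" "s < blinfun_apply a y" and z: "z \<in> Y" for a z
  proof -
    have le_q: "blinfun_apply a z \<le> q z" if "z \<in> Y" for z
      using cSUP_upper[OF a(1) bdd, of z] g_le[OF that] by (simp add: g_def)
    obtain L where L: "linear L" "L \<le> q" "\<forall>z\<in>Y. L z = blinfun_apply a z"
      by (rule blinfun_extension_dominated[OF sub Y le_q])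
    with a(2) y(1) have "q x - t < L x" by (intro slice) auto
    then show ?thesis using near[OF L(1,2)] L(3) z by metis
  qed
  obtain a where a: "a \<in> A" "s < blinfun_apply a y"
    using y(2) less_cSUP_iff[OF A(1) bdd] unfolding g_def by blast
  have "norm_on Y (a - b) \<le> e"
    if "a \<in> A" "b \<in> A" "s < blinfun_apply a y" "s < blinfun_apply b y" for a b
    by (rule norm_on_diff_le[OF Y_ne less_imp_le[OF e] near_D[OF that(1,3)] near_D[OF that(2,4)]])
  then show thesis using that[OF y(1) a] by blast
qed

lemma uncountable_condensation:
  assumes A: "uncountable A" and "countable \<H>"
  obtains A' where "A' \<subseteq> A" "A' \<noteq> {}" "\<forall>H\<in>\<H>. A' \<inter> H \<noteq> {} \<longrightarrow> uncountable (A' \<inter> H)"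
proof -
  define N where "N = (\<Union>H\<in>{H \<in> \<H>. countable (A \<inter> H)}. A \<inter> H)"
  have "countable {H \<in> \<H>. countable (A \<inter> H)}"
    by (rule countable_subset[OF _ assms(2)]) auto
  then have N: "countable N" unfolding N_def by (rule countable_UN) simp
  show thesis
  proof (rule that[of "A - N"])
    show "A - N \<noteq> {}" using uncountable_minus_countable[OF A N] by (metis countable_empty)
    show "\<forall>H\<in>\<H>. (A - N) \<inter> H \<noteq> {} \<longrightarrow> uncountable ((A - N) \<inter> H)"
    proof (intro ballI impI)
      fix H assume "H \<in> \<H>" "(A - N) \<inter> H \<noteq> {}"
      then have "uncountable (A \<inter> H)" by (auto simp: N_def)
      moreover have "(A - N) \<inter> H = (A \<inter> H) - N" by blast
      ultimately show "uncountable ((A - N) \<inter> H)" using uncountable_minus_countable[OF _ N] by metis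
    qed
  qed auto
qed

lemma dual_halfspace_rational_approx:
  fixes a :: "'a::real_normed_vector \<Rightarrow>\<^sub>L real"
  assumes y: "y \<in> closure C" and a: "s < blinfun_apply a y" "norm a \<le> c"
  obtains j \<sigma> where "j \<in> C" "\<sigma> \<in> \<rat>" "\<sigma> < blinfun_apply a j"
    "\<forall>b\<in>cball 0 c. \<sigma> < blinfun_apply b j \<longrightarrow> s < blinfun_apply b y"
proof -
  have c: "0 \<le> c" using a(2) norm_ge_zero[of a] by linarith
  define \<gamma> where "\<gamma> = (a y - s) / 3"
  have \<gamma>: "0 < \<gamma>" "a y = s + 3 * \<gamma>" using a(1) by (simp_all add: \<gamma>_def field_simps)
  have "0 < \<gamma> / (c + 1)" using \<gamma>(1) c by simp
  then obtain j where j: "j \<in> C" "norm (y - j) < \<gamma> / (c + 1)"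
    using y by (metis closure_approachable dist_norm norm_minus_commute)
  have near: "\<bar>blinfun_apply b y - blinfun_apply b j\<bar> \<le> \<gamma>" if "norm b \<le> c" for b
  proof -
    have "\<bar>blinfun_apply b (y - j)\<bar> \<le> c * norm (y - j)" by (rule abs_blinfun_le[OF that])
    also have "\<dots> \<le> (c + 1) * (\<gamma> / (c + 1))" using j(2) c by (intro mult_mono) auto
    finally show ?thesis using c by (simp add: blinfun.diff_right)
  qed
  have "s + \<gamma> < a j" using near[OF a(2)] \<gamma> by linarith
  then obtain \<sigma> where \<sigma>: "\<sigma> \<in> \<rat>" "s + \<gamma> < \<sigma>" "\<sigma> < a j"
    using Rats_dense_in_real by blast
  have "s < blinfun_apply b y" if "norm b \<le> c" "\<sigma> < blinfun_apply b j" for b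
    using near[OF that(1)] that(2) \<sigma>(2) by linarith
  then show thesis using that[OF j(1) \<sigma>(1,3)] by simp
qed

lemma asplund_separated_countable:
  fixes A :: "('a::real_normed_vector \<Rightarrow>\<^sub>L real) set"
  assumes asplund: "asplund TYPE('a)" and Y: "subspace Y" "Y \<subseteq> closure C" "countable C"
    and A: "A \<subseteq> cball 0 c" and e: "0 < e" and sep: "pairwise (\<lambda>a b. e < norm_on Y (a - b)) A"
  shows "countable A"
proof (rule ccontr)
  assume "uncountable A"
  define H :: "'a \<times> real \<Rightarrow> ('a \<Rightarrow>\<^sub>L real) set" where "H = (\<lambda>(j, \<sigma>). {b. \<sigma> < blinfun_apply b j})"
  have "countable (H ` (C \<times> \<rat>))" by (intro countable_image countable_SIGMA Y(3) countable_rat)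
  then obtain A' where A': "A' \<subseteq> A" "A' \<noteq> {}"
    and cond: "\<forall>h\<in>H ` (C \<times> \<rat>). A' \<inter> h \<noteq> {} \<longrightarrow> uncountable (A' \<inter> h)"
    using uncountable_condensation[OF \<open>uncountable A\<close>] by blast
  obtain y s a where y: "y \<in> Y" and a: "a \<in> A'" "s < blinfun_apply a y"
    and small: "\<forall>a\<in>A'. \<forall>b\<in>A'. s < blinfun_apply a y \<longrightarrow> s < blinfun_apply b y \<longrightarrow> norm_on Y (a - b) \<le> e"
    by (rule asplund_small_slice[OF asplund Y(1) A'(2) order.trans[OF A'(1) A] e])
  have "norm a \<le> c" using a(1) A A'(1) by auto
  then obtain j \<sigma> where j: "j \<in> C" "\<sigma> \<in> \<rat>" "\<sigma> < blinfun_apply a j"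
    and inside: "\<forall>b\<in>cball 0 c. \<sigma> < blinfun_apply b j \<longrightarrow> s < blinfun_apply b y"
    using dual_halfspace_rational_approx[OF subsetD[OF Y(2) y] a(2)] by blast
  have "uncountable (A' \<inter> H (j, \<sigma>))" using cond j a(1) by (force simp: H_def)
  then have "uncountable (A' \<inter> H (j, \<sigma>) - {a})" by (intro uncountable_minus_countable) auto
  then have "A' \<inter> H (j, \<sigma>) - {a} \<noteq> {}" by (metis countable_empty)
  then obtain b where b: "b \<in> A'" "b \<noteq> a" "\<sigma> < blinfun_apply b j" by (auto simp: H_def)
  then have "s < blinfun_apply b y" using inside A A'(1) by blast
  then have "norm_on Y (a - b) \<le> e" using small a b(1) by blast
  moreover have "e < norm_on Y (a - b)" by (rule pairwiseD[OF sep]) (use A'(1) a(1) b(1,2) in auto)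
  ultimately show False by linarith
qed

lemma maximal_pairwise_subset:
  assumes sym: "\<And>a b. R a b \<Longrightarrow> R b a"
  obtains M where "M \<subseteq> S" "pairwise R M" "\<forall>x\<in>S - M. \<exists>a\<in>M. \<not> R x a"
proof -
  have "\<exists>M\<in>{M. M \<subseteq> S \<and> pairwise R M}. \<forall>X\<in>{M. M \<subseteq> S \<and> pairwise R M}. M \<subseteq> X \<longrightarrow> X = M"
  proof (rule subset_Zorn')
    show "\<Union>\<C> \<in> {M. M \<subseteq> S \<and> pairwise R M}" if "subset.chain {M. M \<subseteq> S \<and> pairwise R M} \<C>" for \<C>
      using that pairwise_chain_Union[of \<C> R] by (auto simp: subset_chain_def chain_subset_def)
  qed
  then obtain M where M: "M \<subseteq> S" "pairwise R M" "\<And>X. X \<subseteq> S \<Longrightarrow> pairwise R X \<Longrightarrow> M \<subseteq> X \<Longrightarrow> X = M"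
    by auto
  have "\<exists>a\<in>M. \<not> R x a" if "x \<in> S" "x \<notin> M" for x
  proof (rule ccontr)
    assume "\<not> ?thesis"
    then have "pairwise R (insert x M)" using M(2) sym by (auto simp: pairwise_insert)
    then have "insert x M = M" using M(1) that(1) by (intro M(3)) auto
    then show False using that(2) by blast
  qed
  then show thesis using that[OF M(1,2)] by blast
qed

lemma asplund_separable_dual:
  fixes Y C :: "'a::real_normed_vector set"
  assumes asplund: "asplund TYPE('a)" and Y: "subspace Y" "Y \<subseteq> closure C" "countable C"
  obtains D where "countable D" "D \<subseteq> cball (0 :: 'a \<Rightarrow>\<^sub>L real) c"
    "\<And>u e. norm u \<le> c \<Longrightarrow> 0 < e \<Longrightarrow> \<exists>d\<in>D. norm_on Y (u - d) \<le> e"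
proof -
  have Y_ne: "Y \<noteq> {}" using subspace_0[OF Y(1)] by blast
  have "\<exists>A. countable A \<and> A \<subseteq> cball 0 c \<and> (\<forall>u\<in>cball 0 c. \<exists>a\<in>A. norm_on Y (u - a) \<le> e)" if e: "0 < e"
    for e
  proof -
    have sym: "e < norm_on Y (b - a)" if "e < norm_on Y (a - b)" for a b
      using that norm_on_minus_commute[of Y a b] by simp
    obtain A where A: "A \<subseteq> cball 0 c" "pairwise (\<lambda>a b. e < norm_on Y (a - b)) A"
      and max: "\<forall>u\<in>cball 0 c - A. \<exists>a\<in>A. \<not> e < norm_on Y (u - a)"
      by (rule maximal_pairwise_subset[OF sym])
    have "\<exists>a\<in>A. norm_on Y (u - a) \<le> e" if "u \<in> cball 0 c" for u
    proof (cases "u \<in> A")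
      case True
      then show ?thesis using e sublinear_0[OF sublinear_norm_on[OF Y_ne]]
        by (intro bexI[of _ u]) auto
    qed (use max that in \<open>simp add: not_less\<close>)
    then show ?thesis using asplund_separated_countable[OF asplund Y A(1) e A(2)] A(1) by blast
  qed
  then have "\<forall>n. \<exists>A. countable A \<and> A \<subseteq> cball 0 c \<and>
      (\<forall>u\<in>cball 0 c. \<exists>a\<in>A. norm_on Y (u - a) \<le> inverse (real (Suc n)))"
    by simp
  from choice[OF this] obtain A where A: "\<And>n. countable (A n)" "\<And>n. A n \<subseteq> cball 0 c"
    and near: "\<And>n. \<forall>u\<in>cball 0 c. \<exists>a\<in>A n. norm_on Y (u - a) \<le> inverse (real (Suc n))"
    by metis
  show thesis
  proof (rule that[of "\<Union>n. A n"])
    fix u :: "'a \<Rightarrow>\<^sub>L real" and e :: real assume u: "norm u \<le> c" and "0 < e"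
    then obtain n where n: "inverse (real (Suc n)) < e" using reals_Archimedean by blast
    obtain a where "a \<in> A n" "norm_on Y (u - a) \<le> inverse (real (Suc n))"
      using bspec[OF near[of n], of u] u by auto
    then show "\<exists>d\<in>\<Union>n. A n. norm_on Y (u - d) \<le> e" using n by (intro bexI[of _ a]) auto
  qed (use A in auto)
qed

section \<open>Smooth approximation of the norm\<close>

definition supergrad_on :: "'a::real_normed_vector set \<Rightarrow> ('a \<Rightarrow> real) \<Rightarrow> 'a \<Rightarrow> ('a \<Rightarrow>\<^sub>L real) \<Rightarrow> bool" where
  "supergrad_on Y V z \<xi> \<longleftrightarrow>
    (\<forall>r>0. \<forall>\<^sub>F h in at 0 within Y. V (z + h) \<le> V z + blinfun_apply \<xi> h + r * norm h)"

definition norm_gauge :: "real \<Rightarrow> real \<Rightarrow> ('a::real_normed_vector \<Rightarrow> real) \<Rightarrow> bool" where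
  "norm_gauge a s W \<longleftrightarrow> a-lipschitz_on UNIV W \<and> W 0 \<le> 0 \<and> (\<forall>z. a * norm z - s \<le> W z)"

lemma bounded_pointwise_Cauchy_closure:
  fixes x :: "nat \<Rightarrow> 'a::real_normed_vector \<Rightarrow>\<^sub>L real"
  assumes x: "\<And>k. norm (x k) \<le> c" and Cauchy: "\<And>y. y \<in> S \<Longrightarrow> Cauchy (\<lambda>k. blinfun_apply (x k) y)"
    and y: "y \<in> closure S"
  shows "Cauchy (\<lambda>k. blinfun_apply (x k) y)"
proof (rule metric_CauchyI)
  fix r :: real assume r: "0 < r"
  have c: "0 \<le> c" using x[of 0] norm_ge_zero order.trans by blast
  define \<epsilon> where "\<epsilon> = r / 3"
  have "0 < \<epsilon> / (c + 1)" using r c by (simp add: \<epsilon>_def)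
  then obtain j where j: "j \<in> S" "norm (y - j) < \<epsilon> / (c + 1)"
    using y by (metis closure_approachable dist_norm norm_minus_commute)
  have near: "\<bar>blinfun_apply (x k) y - blinfun_apply (x k) j\<bar> \<le> \<epsilon>" for k
  proof -
    have "\<bar>blinfun_apply (x k) (y - j)\<bar> \<le> c * norm (y - j)" by (rule abs_blinfun_le[OF x])
    also have "\<dots> \<le> (c + 1) * (\<epsilon> / (c + 1))" using j(2) c by (intro mult_mono) auto
    finally show ?thesis using c by (simp add: blinfun.diff_right)
  qed
  obtain M where M: "\<forall>m\<ge>M. \<forall>n\<ge>M. dist (blinfun_apply (x m) j) (blinfun_apply (x n) j) < \<epsilon>"
    using metric_CauchyD[OF Cauchy[OF j(1)], of \<epsilon>] r unfolding \<epsilon>_def by auto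
  have "dist (blinfun_apply (x m) y) (blinfun_apply (x n) y) < r" if "M \<le> m" "M \<le> n" for m n
  proof -
    have "dist (blinfun_apply (x m) j) (blinfun_apply (x n) j) < \<epsilon>" using M that by blast
    with near[of m] near[of n] show ?thesis unfolding dist_real_def \<epsilon>_def by linarith
  qed
  then show "\<exists>M. \<forall>m\<ge>M. \<forall>n\<ge>M. dist (blinfun_apply (x m) y) (blinfun_apply (x n) y) < r" by blast
qed

lemma bounded_pointwise_limit:
  fixes x :: "nat \<Rightarrow> 'a::real_normed_vector \<Rightarrow>\<^sub>L real"
  assumes Y: "subspace Y" and x: "\<And>k. norm (x k) \<le> c"
    and Cauchy: "\<And>y. y \<in> Y \<Longrightarrow> Cauchy (\<lambda>k. blinfun_apply (x k) y)"
  obtains \<xi> where "norm \<xi> \<le> c" "\<forall>y\<in>Y. (\<lambda>k. blinfun_apply (x k) y) \<longlonglongrightarrow> blinfun_apply \<xi> y"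
proof -
  have c: "0 \<le> c" using x[of 0] norm_ge_zero order.trans by blast
  define g where "g y = lim (\<lambda>k. blinfun_apply (x k) y)" for y
  have g: "(\<lambda>k. blinfun_apply (x k) y) \<longlonglongrightarrow> g y" if "y \<in> Y" for y
    unfolding g_def using Cauchy_convergent[OF Cauchy[OF that]] by (simp add: convergent_LIMSEQ_iff)
  have add: "g (y + y') = g y + g y'" if "y \<in> Y" "y' \<in> Y" for y y'
    using LIMSEQ_unique[OF g[OF subspace_add[OF Y that]]]
      tendsto_add[OF g[OF that(1)] g[OF that(2)]]
    by (simp add: blinfun.add_right)
  have scale: "g (t *\<^sub>R y) = t * g y" if "y \<in> Y" for t y
    using LIMSEQ_unique[OF g[OF subspace_scale[OF Y that]]] tendsto_mult_left[OF g[OF that], of t]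
    by (simp add: blinfun.scaleR_right)
  have le: "g y \<le> c * norm y" if "y \<in> Y" for y
    using abs_blinfun_le[OF x, of _ y]
    by (intro LIMSEQ_le_const2[OF g[OF that]]) (auto simp: abs_le_iff)
  obtain L where L: "linear L" "L \<le> (\<lambda>y. c * norm y)" and L_eq: "\<forall>y\<in>Y. L y = g y"
    by (rule hahn_banach_dominated[OF sublinear_norm[OF c] Y add scale le]) auto
  obtain \<xi> :: "'a \<Rightarrow>\<^sub>L real" where \<xi>: "norm \<xi> \<le> c" "\<forall>y. \<xi> y = L y"
    using linear_bounded_imp_blinfun[OF L(1) le_funD[OF L(2)] c] by blast
  have "(\<lambda>k. blinfun_apply (x k) y) \<longlonglongrightarrow> \<xi> y" if "y \<in> Y" for y
    using g[OF that] L_eq \<xi>(2) that by simp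
  with \<xi>(1) show thesis by (intro that) auto
qed

lemma norm_on_le_limit:
  assumes "Z \<noteq> {}" and lim: "\<And>z. z \<in> Z \<Longrightarrow> (\<lambda>k. blinfun_apply (x k) z) \<longlonglongrightarrow> blinfun_apply \<xi> z"
    and a: "(\<lambda>k. norm_on Z (x k)) \<longlonglongrightarrow> a"
  shows "norm_on Z \<xi> \<le> a"
proof (rule norm_on_least[OF assms(1)])
  show "0 \<le> a" using norm_on_nonneg[OF assms(1)] by (intro LIMSEQ_le_const[OF a]) auto
  show "\<bar>blinfun_apply \<xi> z\<bar> \<le> a * norm z" if "z \<in> Z" for z
    using abs_blinfun_le_norm_on[OF that]
    by (intro LIMSEQ_le[OF tendsto_rabs[OF lim[OF that]] tendsto_mult_right[OF a]]) auto
qed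

text \<open>The functions \<open>P n\<close> are midpoint convex on the dual ball with the gap \<open>G n\<close>. Subtracting their
  weighted sum from the pairing singles out a point at which the support function is attained.\<close>

locale penalized_dual_ball =
  fixes P :: "nat \<Rightarrow> ('a::real_normed_vector \<Rightarrow>\<^sub>L real) \<Rightarrow> real"
    and G :: "nat \<Rightarrow> ('a \<Rightarrow>\<^sub>L real) \<Rightarrow> ('a \<Rightarrow>\<^sub>L real) \<Rightarrow> real"
    and c B \<kappa> :: real
  assumes c: "0 < c" and \<kappa>: "0 < \<kappa>"
    and P_nonneg: "0 \<le> P n u" and P_le: "norm u \<le> c \<Longrightarrow> P n u \<le> B"
    and G_nonneg: "0 \<le> G n u w" and P_midpoint: "P n (midpoint u w) \<le> (P n u + P n w) / 2 - G n u w"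
begin

definition "penalty u = \<kappa> * (\<Sum>n. (1/2)^n * P n u)"

definition "smooth_norm z = (SUP u\<in>cball 0 c. blinfun_apply u z - penalty u)"

definition "near_maximizer z t u \<longleftrightarrow> norm u \<le> c \<and> smooth_norm z - t \<le> blinfun_apply u z - penalty u"

lemma penalty_summable: "norm u \<le> c \<Longrightarrow> summable (\<lambda>n. (1/2)^n * P n u)"
proof (rule summable_comparison_test')
  show "summable (\<lambda>n. (1/2)^n * B)" by (intro summable_mult2 summable_geometric) simp
  show "norm ((1/2)^n * P n u) \<le> (1/2)^n * B" if "norm u \<le> c" for n
    using P_le[OF that, of n] P_nonneg[of n u] by (simp add: abs_mult mult_left_mono)
qed

lemma penalty_nonneg: "norm u \<le> c \<Longrightarrow> 0 \<le> penalty u"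
  unfolding penalty_def using \<kappa> penalty_summable P_nonneg
  by (intro mult_nonneg_nonneg suminf_nonneg) auto

lemma penalty_le:
  assumes "norm u \<le> c"
  shows "penalty u \<le> \<kappa> * (2 * B)"
proof -
  have "(\<lambda>n. (1/2)^n * B) sums (2 * B)"
    using sums_mult2[OF geometric_sums[of "1/2::real"], of B] by simp
  then have "(\<Sum>n. (1/2)^n * P n u) \<le> 2 * B"
    by (rule sums_le[OF _ summable_sums[OF penalty_summable[OF assms]], rotated])
      (simp add: mult_left_mono P_le[OF assms])
  then show ?thesis unfolding penalty_def using \<kappa> by (intro mult_left_mono) auto
qed

lemma smooth_norm_bdd_above: "bdd_above ((\<lambda>u. blinfun_apply u z - penalty u) ` cball 0 c)"
proof (rule bdd_aboveI2)
  show "blinfun_apply u z - penalty u \<le> c * norm z" if "u \<in> cball 0 c" for u :: "'a \<Rightarrow>\<^sub>L real"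
    using abs_blinfun_le[of u c z] penalty_nonneg[of u] that by simp
qed

lemma smooth_norm_upper: "norm u \<le> c \<Longrightarrow> blinfun_apply u z - penalty u \<le> smooth_norm z"
  unfolding smooth_norm_def by (rule cSUP_upper[OF _ smooth_norm_bdd_above]) simp

lemma smooth_norm_least: "(\<And>u. norm u \<le> c \<Longrightarrow> blinfun_apply u z - penalty u \<le> K) \<Longrightarrow> smooth_norm z \<le> K"
  unfolding smooth_norm_def using c by (intro cSUP_least) auto

lemma near_maximizer_exists:
  assumes "0 < t"
  obtains u where "near_maximizer z t u"
proof -
  obtain u :: "'a \<Rightarrow>\<^sub>L real" where "u \<in> cball 0 c" "smooth_norm z - t < blinfun_apply u z - penalty u"
    using less_cSUP_iff[OF _ smooth_norm_bdd_above, of "smooth_norm z - t" z] assms c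
    unfolding smooth_norm_def by auto
  then show thesis by (intro that[of u]) (simp add: near_maximizer_def)
qed

lemma smooth_norm_lipschitz: "c-lipschitz_on UNIV smooth_norm"
proof (rule lipschitz_onI)
  have le: "smooth_norm x \<le> smooth_norm y + c * dist x y" for x y
  proof (rule smooth_norm_least)
    fix u :: "'a \<Rightarrow>\<^sub>L real" assume u: "norm u \<le> c"
    from smooth_norm_upper[OF u, of y] abs_blinfun_le[OF u, of "x - y"]
    show "blinfun_apply u x - penalty u \<le> smooth_norm y + c * dist x y"
      by (simp add: blinfun.diff_right dist_norm)
  qed
  show "dist (smooth_norm x) (smooth_norm y) \<le> c * dist x y" for x y
    using le[of x y] le[of y x] by (simp add: dist_real_def dist_commute abs_le_iff)
qed (use c in simp)

lemma norm_gauge_smooth_norm: "norm_gauge c (\<kappa> * (2 * B)) smooth_norm"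
  unfolding norm_gauge_def
proof (intro conjI allI smooth_norm_lipschitz)
  show "smooth_norm 0 \<le> 0"
    using penalty_nonneg by (intro smooth_norm_least) (simp add: blinfun.zero_right)
  fix z
  obtain u :: "'a \<Rightarrow>\<^sub>L real" where u: "norm u \<le> c" "u z = c * norm z"
    using norming_functional[of c z] c by auto
  show "c * norm z - \<kappa> * (2 * B) \<le> smooth_norm z"
    using smooth_norm_upper[OF u(1), of z] penalty_le[OF u(1)] u(2) by linarith
qed

lemma norm_midpoint_le: "norm u \<le> c \<Longrightarrow> norm w \<le> c \<Longrightarrow> norm (midpoint u w) \<le> c"
  for u w :: "'a \<Rightarrow>\<^sub>L real"
  using norm_triangle_ineq[of u w] by (simp add: midpoint_def)

lemma penalty_midpoint:
  assumes u: "norm u \<le> c" and w: "norm w \<le> c"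
  shows "penalty (midpoint u w) + \<kappa> * ((1/2)^n * G n u w) \<le> (penalty u + penalty w) / 2"
proof -
  note sums = summable_sums[OF penalty_summable]
  define D where "D k = (1/2)^k * ((P k u + P k w) / 2 - P k (midpoint u w))" for k
  have "(\<lambda>k. ((1/2)^k * P k u + (1/2)^k * P k w) / 2 - (1/2)^k * P k (midpoint u w)) sums
      (((\<Sum>k. (1/2)^k * P k u) + (\<Sum>k. (1/2)^k * P k w)) / 2
      - (\<Sum>k. (1/2)^k * P k (midpoint u w)))"
    using u w norm_midpoint_le by (intro sums_diff sums_divide sums_add sums)
  then have D: "D sums (((\<Sum>k. (1/2)^k * P k u) + (\<Sum>k. (1/2)^k * P k w)) / 2
      - (\<Sum>k. (1/2)^k * P k (midpoint u w)))"
    by (simp add: D_def[abs_def] algebra_simps)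
  have "G k u w \<le> (P k u + P k w) / 2 - P k (midpoint u w)" for k
    using P_midpoint[of k u w] by simp
  then have G: "(1/2)^k * G k u w \<le> D k" for k
    unfolding D_def by (intro mult_left_mono) auto
  have D_nonneg: "0 \<le> D k" for k
    using order.trans[OF _ G[of k]] G_nonneg[of k u w] by simp
  have "(1/2)^n * G n u w \<le> D n" by (rule G)
  also have "\<dots> \<le> suminf D" using sum_le_suminf[OF sums_summable[OF D], of "{n}"] D_nonneg by simp
  finally have "\<kappa> * ((1/2)^n * G n u w) \<le> \<kappa> * suminf D" using \<kappa> by (intro mult_left_mono) auto
  then show ?thesis unfolding sums_unique[OF D, symmetric] penalty_def by (simp add: field_simps)
qed

lemma near_maximizers_gap:
  assumes u: "near_maximizer z t u" and w: "near_maximizer z t w"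
  shows "\<kappa> * ((1/2)^n * G n u w) \<le> t"
proof -
  have norms: "norm u \<le> c" "norm w \<le> c" using u w by (auto simp: near_maximizer_def)
  have "blinfun_apply (midpoint u w) z = (blinfun_apply u z + blinfun_apply w z) / 2"
    by (simp add: midpoint_def blinfun.add_left blinfun.scaleR_left)
  with smooth_norm_upper[OF norm_midpoint_le[OF norms], of z]
  have "(blinfun_apply u z + blinfun_apply w z) / 2 - penalty (midpoint u w) \<le> smooth_norm z"
    by simp
  with penalty_midpoint[OF norms, of n] u w show ?thesis
    unfolding near_maximizer_def by argo
qed

lemma maximizing_sequence_gap:
  assumes x: "\<And>k. near_maximizer z (inverse (real (Suc k))) (x k)" and r: "0 < r"
  shows "\<exists>M. \<forall>k\<ge>M. \<forall>l\<ge>M. G n (x k) (x l) < r"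
proof -
  define C where "C = \<kappa> * (1/2)^n"
  have C: "0 < C" using \<kappa> by (simp add: C_def)
  obtain M where M: "inverse (real (Suc M)) < C * r"
    using reals_Archimedean[of "C * r"] C r by auto
  have near: "near_maximizer z (inverse (real (Suc M))) (x k)" if "M \<le> k" for k
  proof -
    have "inverse (real (Suc k)) \<le> inverse (real (Suc M))" using that by simp
    then show ?thesis using x[of k] unfolding near_maximizer_def by linarith
  qed
  have "G n (x k) (x l) < r" if "M \<le> k" "M \<le> l" for k l
  proof -
    have "C * G n (x k) (x l) < C * r"
      using near_maximizers_gap[OF near[OF that(1)] near[OF that(2)], of n] M by (simp add: C_def)
    then show ?thesis using C by simp
  qed
  then show ?thesis by blast
qed

lemma penalty_le_limit:
  assumes \<xi>: "norm \<xi> \<le> c" and x: "\<And>k. norm (x k) \<le> c"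
    and lim: "\<And>n. (\<lambda>k. P n (x k)) \<longlonglongrightarrow> a n" and P_\<xi>: "\<And>n. P n \<xi> \<le> a n"
    and b: "\<And>k. penalty (x k) \<le> b k" "b \<longlonglongrightarrow> \<beta>"
  shows "penalty \<xi> \<le> \<beta>"
proof -
  have "\<kappa> * (\<Sum>n<N. (1/2)^n * P n \<xi>) \<le> \<beta>" for N
  proof -
    have "\<kappa> * (\<Sum>n<N. (1/2)^n * P n \<xi>) \<le> \<kappa> * (\<Sum>n<N. (1/2)^n * a n)"
      using \<kappa> P_\<xi> by (intro mult_left_mono sum_mono) auto
    also have "\<dots> \<le> \<beta>"
    proof (rule LIMSEQ_le[OF _ b(2)])
      show "(\<lambda>k. \<kappa> * (\<Sum>n<N. (1/2)^n * P n (x k))) \<longlonglongrightarrow> \<kappa> * (\<Sum>n<N. (1/2)^n * a n)"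
        by (intro tendsto_intros lim)
      have "\<kappa> * (\<Sum>n<N. (1/2)^n * P n (x k)) \<le> b k" for k
      proof (rule order.trans[OF _ b(1)])
        have "(\<Sum>n<N. (1/2)^n * P n (x k)) \<le> (\<Sum>n. (1/2)^n * P n (x k))"
          using P_nonneg by (intro sum_le_suminf penalty_summable x) auto
        then show "\<kappa> * (\<Sum>n<N. (1/2)^n * P n (x k)) \<le> penalty (x k)"
          unfolding penalty_def using \<kappa> by (intro mult_left_mono) auto
      qed
      then show "\<exists>M. \<forall>k\<ge>M. \<kappa> * (\<Sum>n<N. (1/2)^n * P n (x k)) \<le> b k" by blast
    qed
    finally show ?thesis .
  qed
  then have "(\<Sum>n. (1/2)^n * P n \<xi>) \<le> \<beta> / \<kappa>"
    using \<kappa> by (intro suminf_le_const penalty_summable \<xi>) (simp add: field_simps)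
  then show ?thesis using \<kappa> by (simp add: penalty_def field_simps)
qed

end

lemma square_midpoint_gap:
  fixes a b m :: real
  assumes "\<bar>m\<bar> \<le> \<bar>a + b\<bar> / 2"
  shows "m\<^sup>2 \<le> (a\<^sup>2 + b\<^sup>2) / 2 - (a - b)\<^sup>2 / 4"
proof -
  have "m\<^sup>2 \<le> ((a + b) / 2)\<^sup>2" using assms by (simp add: abs_le_square_iff[symmetric])
  also have "\<dots> = (a\<^sup>2 + b\<^sup>2) / 2 - (a - b)\<^sup>2 / 4" by (simp add: power2_eq_square field_simps)
  finally show ?thesis .
qed

text \<open>The squared distances to the dense sequence \<open>d\<close> make near maximizers cluster in the dual norm of
  \<open>Y\<close>; the evaluations at \<open>e\<close> make maximizing sequences converge pointwise on \<open>Y\<close>.\<close>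

locale separable_dual =
  fixes Y :: "'a::real_normed_vector set" and d :: "nat \<Rightarrow> ('a \<Rightarrow>\<^sub>L real)" and e :: "nat \<Rightarrow> 'a"
    and c \<kappa> :: real
  assumes Y: "subspace Y" and e_in: "\<And>n. e n \<in> Y" and e_dense: "Y \<subseteq> closure (range e)"
    and d_le: "\<And>n. norm (d n) \<le> c"
    and d_dense: "\<And>u r. norm u \<le> c \<Longrightarrow> 0 < r \<Longrightarrow> \<exists>n. norm_on Y (u - d n) \<le> r"
    and c: "0 < c" and \<kappa>: "0 < \<kappa>"
begin

definition "P n u = (norm_on Y (u - d n))\<^sup>2 + (blinfun_apply u (sgn (e n)))\<^sup>2"

definition "G n u w = (norm_on Y (u - d n) - norm_on Y (w - d n))\<^sup>2 / 4
    + (blinfun_apply u (sgn (e n)) - blinfun_apply w (sgn (e n)))\<^sup>2 / 4"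

lemma Y_nonempty: "Y \<noteq> {}"
  using e_in by blast

lemma P_le_square:
  assumes u: "norm u \<le> c"
  shows "P n u \<le> 5 * c\<^sup>2"
proof -
  have "norm_on Y (u - d n) \<le> 2 * c"
    using norm_on_le_norm[OF Y_nonempty, of "u - d n"] norm_triangle_ineq4[of u "d n"] u d_le[of n]
    by linarith
  then have "(norm_on Y (u - d n))\<^sup>2 \<le> (2 * c)\<^sup>2"
    by (rule power_mono) (rule norm_on_nonneg[OF Y_nonempty])
  moreover have "norm (sgn (e n)) \<le> 1" by (simp add: norm_sgn)
  then have "\<bar>blinfun_apply u (sgn (e n))\<bar> \<le> \<bar>c\<bar>"
    using abs_blinfun_le[OF u, of "sgn (e n)"] mult_left_le[of "norm (sgn (e n))" c] c by linarith
  then have "(blinfun_apply u (sgn (e n)))\<^sup>2 \<le> c\<^sup>2" by (simp add: abs_le_square_iff)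
  ultimately show ?thesis by (simp add: P_def power_mult_distrib)
qed

lemma P_midpoint_gap: "P n (midpoint u w) \<le> (P n u + P n w) / 2 - G n u w"
proof -
  let ?b = "sgn (e n)"
  have "midpoint u w - d n = (1/2) *\<^sub>R ((u - d n) + (w - d n))"
    by (simp add: midpoint_def algebra_simps flip: scaleR_add_left)
  then have "norm_on Y (midpoint u w - d n) \<le> (norm_on Y (u - d n) + norm_on Y (w - d n)) / 2"
    using sublinear_scaleR[OF sublinear_norm_on[OF Y_nonempty], of "1/2" "(u - d n) + (w - d n)"]
      sublinear_add[OF sublinear_norm_on[OF Y_nonempty], of "u - d n" "w - d n"] by simp
  then have "(norm_on Y (midpoint u w - d n))\<^sup>2 \<le> ((norm_on Y (u - d n))\<^sup>2 + (norm_on Y (w - d n))\<^sup>2) / 2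
      - (norm_on Y (u - d n) - norm_on Y (w - d n))\<^sup>2 / 4"
    using norm_on_nonneg[OF Y_nonempty] by (intro square_midpoint_gap) (simp add: add_nonneg_nonneg)
  moreover have "(blinfun_apply (midpoint u w) ?b)\<^sup>2
      \<le> ((blinfun_apply u ?b)\<^sup>2 + (blinfun_apply w ?b)\<^sup>2) / 2
      - (blinfun_apply u ?b - blinfun_apply w ?b)\<^sup>2 / 4"
    by (intro square_midpoint_gap) (simp add: midpoint_def blinfun.add_left blinfun.scaleR_left)
  ultimately show ?thesis
    unfolding P_def G_def add_divide_distrib by linarith
qed

sublocale penalized_dual_ball P G c "5 * c\<^sup>2" \<kappa>
proof
  show "P n (midpoint u w) \<le> (P n u + P n w) / 2 - G n u w" for n u w by (rule P_midpoint_gap)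
qed (auto simp: c \<kappa> P_le_square, auto simp: P_def G_def)

lemma maximizing_sequence_Cauchy:
  assumes x: "\<And>k. near_maximizer z (inverse (real (Suc k))) (x k)"
  shows "Cauchy (\<lambda>k. norm_on Y (x k - d n))" and "y \<in> Y \<Longrightarrow> Cauchy (\<lambda>k. blinfun_apply (x k) y)"
proof -
  have "\<exists>M. \<forall>k\<ge>M. \<forall>l\<ge>M. dist (norm_on Y (x k - d n)) (norm_on Y (x l - d n)) < r \<and>
      dist (blinfun_apply (x k) (sgn (e n))) (blinfun_apply (x l) (sgn (e n))) < r"
    if r: "0 < r" for r n
  proof -
    obtain M where M: "\<forall>k\<ge>M. \<forall>l\<ge>M. G n (x k) (x l) < r\<^sup>2 / 4"
      using maximizing_sequence_gap[OF x, of "r\<^sup>2 / 4" n] r by auto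
    have less: "\<bar>a\<bar> < r \<and> \<bar>b\<bar> < r" if "a\<^sup>2 / 4 + b\<^sup>2 / 4 < r\<^sup>2 / 4" for a b :: real
    proof -
      have "a\<^sup>2 < r\<^sup>2" "b\<^sup>2 < r\<^sup>2" using that zero_le_power2[of a] zero_le_power2[of b] by linarith+
      then show ?thesis using r power2_less_imp_less[of "\<bar>a\<bar>" r] power2_less_imp_less[of "\<bar>b\<bar>" r]
        by simp
    qed
    have "dist (norm_on Y (x k - d n)) (norm_on Y (x l - d n)) < r \<and>
        dist (blinfun_apply (x k) (sgn (e n))) (blinfun_apply (x l) (sgn (e n))) < r"
      if "M \<le> k" "M \<le> l" for k l
      unfolding dist_real_def by (rule less) (use M that in \<open>auto simp: G_def\<close>)
    then show ?thesis by blast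
  qed
  then have Cauchy: "Cauchy (\<lambda>k. norm_on Y (x k - d n))"
    "Cauchy (\<lambda>k. blinfun_apply (x k) (sgn (e n)))" for n
    unfolding Cauchy_def by meson+
  show "Cauchy (\<lambda>k. norm_on Y (x k - d n))" by (rule Cauchy)
  have "blinfun_apply u (e n) = norm (e n) * blinfun_apply u (sgn (e n))" for u :: "'a \<Rightarrow>\<^sub>L real"
    and n
    by (cases "e n = 0") (simp_all add: sgn_div_norm blinfun.scaleR_right blinfun.zero_right)
  then have Cauchy_e: "Cauchy (\<lambda>k. blinfun_apply (x k) (e n))" for n
    using bounded_linear.Cauchy[OF bounded_linear_mult_right Cauchy(2)[of n], of "norm (e n)"]
    by simp
  show "Cauchy (\<lambda>k. blinfun_apply (x k) y)" if "y \<in> Y"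
  proof (rule bounded_pointwise_Cauchy_closure)
    show "norm (x k) \<le> c" for k using x[of k] by (simp add: near_maximizer_def)
    show "y \<in> closure (range e)" using e_dense that by blast
  qed (use Cauchy_e in auto)
qed

lemma maximizer_exists:
  assumes z: "z \<in> Y"
  obtains \<xi> where "near_maximizer z 0 \<xi>"
proof -
  have "\<exists>u. near_maximizer z (inverse (real (Suc k))) u" for k
    using near_maximizer_exists[of "inverse (real (Suc k))" z] by auto
  then obtain x where x: "\<And>k. near_maximizer z (inverse (real (Suc k))) (x k)" by metis
  have norm_x: "norm (x k) \<le> c" for k using x[of k] by (simp add: near_maximizer_def)
  note Cauchy = maximizing_sequence_Cauchy[OF x]
  obtain \<xi> where \<xi>: "norm \<xi> \<le> c" "\<forall>y\<in>Y. (\<lambda>k. blinfun_apply (x k) y) \<longlonglongrightarrow> blinfun_apply \<xi> y"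
    by (rule bounded_pointwise_limit[OF Y norm_x Cauchy(2)])
  have e_sgn: "sgn (e n) \<in> Y" for n unfolding sgn_div_norm by (intro subspace_scale Y e_in)
  define a where "a n = lim (\<lambda>k. norm_on Y (x k - d n))" for n
  have a: "(\<lambda>k. norm_on Y (x k - d n)) \<longlonglongrightarrow> a n" for n
    unfolding a_def using Cauchy_convergent[OF Cauchy(1)] by (simp add: convergent_LIMSEQ_iff)
  have "penalty \<xi> \<le> blinfun_apply \<xi> z - smooth_norm z + 0"
  proof (rule penalty_le_limit[OF \<xi>(1) norm_x])
    show "(\<lambda>k. P n (x k)) \<longlonglongrightarrow> (a n)\<^sup>2 + (blinfun_apply \<xi> (sgn (e n)))\<^sup>2" for n
      unfolding P_def by (intro tendsto_intros a bspec[OF \<xi>(2)] e_sgn)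
    have "norm_on Y (\<xi> - d n) \<le> a n" for n
      using \<xi>(2) by (intro norm_on_le_limit[OF Y_nonempty _ a])
        (auto simp: blinfun.diff_left intro!: tendsto_diff)
    then show "P n \<xi> \<le> (a n)\<^sup>2 + (blinfun_apply \<xi> (sgn (e n)))\<^sup>2" for n
      unfolding P_def by (intro add_right_mono power_mono norm_on_nonneg[OF Y_nonempty])
    show "penalty (x k) \<le> blinfun_apply (x k) z - smooth_norm z + inverse (real (Suc k))" for k
      using x[of k] by (simp add: near_maximizer_def)
    show "(\<lambda>k. blinfun_apply (x k) z - smooth_norm z + inverse (real (Suc k)))
        \<longlonglongrightarrow> blinfun_apply \<xi> z - smooth_norm z + 0"
      by (intro tendsto_intros bspec[OF \<xi>(2)] z LIMSEQ_inverse_real_of_nat)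
  qed
  then show thesis using \<xi>(1) by (intro that[of \<xi>]) (simp add: near_maximizer_def)
qed

lemma near_maximizer_close:
  assumes \<xi>: "near_maximizer z 0 \<xi>" and q: "0 < q"
  obtains t where "0 < t" "\<forall>u. near_maximizer z t u \<longrightarrow> norm_on Y (u - \<xi>) \<le> q"
proof -
  define r where "r = q / 3"
  have r: "0 < r" using q by (simp add: r_def)
  obtain n where n: "norm_on Y (\<xi> - d n) \<le> r"
    using d_dense[of \<xi> r] \<xi> r by (auto simp: near_maximizer_def)
  define C where "C = \<kappa> * (1/2)^n"
  have C: "0 < C" using \<kappa> by (simp add: C_def)
  show thesis
  proof (rule that[of "C * (r\<^sup>2 / 4)"])
    show t: "0 < C * (r\<^sup>2 / 4)" using C r by simp
    show "\<forall>u. near_maximizer z (C * (r\<^sup>2 / 4)) u \<longrightarrow> norm_on Y (u - \<xi>) \<le> q"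
    proof (intro allI impI)
      fix u assume u: "near_maximizer z (C * (r\<^sup>2 / 4)) u"
      have "near_maximizer z (C * (r\<^sup>2 / 4)) \<xi>" using \<xi> t by (simp add: near_maximizer_def)
      from near_maximizers_gap[OF u this, of n] have "C * G n u \<xi> \<le> C * (r\<^sup>2 / 4)"
        by (simp add: C_def mult.assoc)
      then have "G n u \<xi> \<le> r\<^sup>2 / 4" using C by simp
      then have "(norm_on Y (u - d n) - norm_on Y (\<xi> - d n))\<^sup>2 \<le> r\<^sup>2"
        using zero_le_power2[of "blinfun_apply u (sgn (e n)) - blinfun_apply \<xi> (sgn (e n))"]
        unfolding G_def by linarith
      then have "norm_on Y (u - d n) - norm_on Y (\<xi> - d n) \<le> r"
        by (rule power2_le_imp_le) (use r in simp)
      moreover have "norm_on Y (u - \<xi>) \<le> norm_on Y (u - d n) + norm_on Y (\<xi> - d n)"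
        using sublinear_add[OF sublinear_norm_on[OF Y_nonempty], of "u - d n" "d n - \<xi>"]
          norm_on_minus_commute[of Y \<xi> "d n"] by simp
      ultimately show "norm_on Y (u - \<xi>) \<le> q" using n by (simp add: r_def)
    qed
  qed
qed

lemma supergrad_on_smooth_norm:
  assumes \<xi>: "near_maximizer z 0 \<xi>"
  shows "supergrad_on Y smooth_norm z \<xi>"
  unfolding supergrad_on_def
proof (intro allI impI)
  fix r :: real assume r: "0 < r"
  obtain t where t: "0 < t" and close: "\<forall>u. near_maximizer z t u \<longrightarrow> norm_on Y (u - \<xi>) \<le> r / 2"
    using near_maximizer_close[OF \<xi>, of "r / 2"] r by auto
  have "0 < t / (2 * c + r / 2)" using t c r by simp
  then have "\<forall>\<^sub>F h in at 0 within Y. h \<in> Y \<and> h \<noteq> 0 \<and> norm h < t / (2 * c + r / 2)"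
    unfolding eventually_at by (auto intro!: exI[of _ "t / (2 * c + r / 2)"])
  then show "\<forall>\<^sub>F h in at 0 within Y.
      smooth_norm (z + h) \<le> smooth_norm z + blinfun_apply \<xi> h + r * norm h"
  proof eventually_elim
    case (elim h)
    then have h: "h \<in> Y" "0 < r / 2 * norm h" "(2 * c + r / 2) * norm h \<le> t"
      using r c by (auto simp: pos_less_divide_eq mult.commute)
    obtain u where u: "near_maximizer (z + h) (r / 2 * norm h) u"
      using near_maximizer_exists[OF h(2)] .
    then have norm_u: "norm u \<le> c" by (simp add: near_maximizer_def)
    have u_ge: "smooth_norm (z + h) - r / 2 * norm h
        \<le> blinfun_apply u z + blinfun_apply u h - penalty u"
      using u by (simp add: near_maximizer_def blinfun.add_right)
    have "smooth_norm z - t \<le> blinfun_apply u z - penalty u"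
    proof -
      have "smooth_norm z - smooth_norm (z + h) \<le> c * norm h"
        using lipschitz_onD[OF smooth_norm_lipschitz, of z "z + h"]
        by (simp add: dist_real_def dist_norm)
      moreover have "blinfun_apply u h \<le> c * norm h" using abs_blinfun_le[OF norm_u, of h] by simp
      ultimately show ?thesis using u_ge h(3) unfolding distrib_right by linarith
    qed
    then have "norm_on Y (u - \<xi>) \<le> r / 2" using close norm_u by (simp add: near_maximizer_def)
    from mult_right_mono[OF this norm_ge_zero[of h]] abs_blinfun_le_norm_on[OF h(1), of "u - \<xi>"]
    have "blinfun_apply u h \<le> blinfun_apply \<xi> h + r / 2 * norm h"
      by (simp add: blinfun.diff_left)
    with u_ge smooth_norm_upper[OF norm_u, of z] show ?case by linarith
  qed
qed

end

lemma asplund_smooth_gauge: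
  fixes Y C :: "'a::real_normed_vector set"
  assumes asplund: "asplund TYPE('a)" and Y: "subspace Y" "Y \<subseteq> closure C"
    and C: "countable C" "C \<subseteq> Y"
    and c: "0 < c" and s: "0 < s"
  obtains W where "norm_gauge c s W" "\<forall>z\<in>Y. \<exists>\<xi>. norm \<xi> \<le> c \<and> supergrad_on Y W z \<xi>"
proof -
  obtain D where D: "countable D" "D \<subseteq> cball (0 :: 'a \<Rightarrow>\<^sub>L real) c"
    and D_dense: "\<And>u e. norm u \<le> c \<Longrightarrow> 0 < e \<Longrightarrow> \<exists>d\<in>D. norm_on Y (u - d) \<le> e"
    using asplund_separable_dual[OF asplund Y C(1)] by metis
  have D_ne: "D \<noteq> {}" using D_dense[of 0 1] c by auto
  have C_ne: "C \<noteq> {}" using Y subspace_0 by fastforce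
  interpret separable_dual Y "from_nat_into D" "from_nat_into C" c "s / (10 * c\<^sup>2)"
  proof
    show "\<exists>n. norm_on Y (u - from_nat_into D n) \<le> r" if "norm u \<le> c" "0 < r"
      for u :: "'a \<Rightarrow>\<^sub>L real" and r
      using D_dense[OF that] from_nat_into_surj[OF D(1)] by metis
    show "norm (from_nat_into D n) \<le> c" for n using D(2) from_nat_into[OF D_ne, of n] by auto
    show "from_nat_into C n \<in> Y" for n using from_nat_into[OF C_ne] C(2) by blast
    show "Y \<subseteq> closure (range (from_nat_into C))" using Y(2) range_from_nat_into[OF C_ne C(1)]
      by simp
  qed (use Y(1) c s in auto)
  show thesis
  proof (rule that)
    show "norm_gauge c s smooth_norm" using norm_gauge_smooth_norm c by simp
    show "\<forall>z\<in>Y. \<exists>\<xi>. norm \<xi> \<le> c \<and> supergrad_on Y smooth_norm z \<xi>"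
      using maximizer_exists supergrad_on_smooth_norm by (metis near_maximizer_def)
  qed
qed

section \<open>A variational principle with gauge perturbations\<close>

lemma norm_gauge_lipschitz: "norm_gauge a s W \<Longrightarrow> a-lipschitz_on UNIV W"
  by (simp add: norm_gauge_def)

lemma norm_gauge_zero: "norm_gauge a s W \<Longrightarrow> W 0 \<le> 0"
  by (simp add: norm_gauge_def)

lemma norm_gauge_lower: "norm_gauge a s W \<Longrightarrow> a * norm z - s \<le> W z"
  by (simp add: norm_gauge_def)

lemma norm_gauge_ge: "norm_gauge a s W \<Longrightarrow> - s \<le> W z"
  using norm_gauge_lower[of a s W z]
    mult_nonneg_nonneg[OF lipschitz_on_nonneg[OF norm_gauge_lipschitz] norm_ge_zero, of a s W z]
  by simp

lemma norm_gauge_upper: "norm_gauge a s W \<Longrightarrow> W z \<le> a * norm z"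
  using lipschitz_onD[OF norm_gauge_lipschitz, of a s W z 0] norm_gauge_zero[of a s W]
  by (simp add: dist_real_def)

lemma lipschitz_on_diff_le:
  assumes "a-lipschitz_on UNIV g"
  shows "g z - g y \<le> a * norm (z - y)"
  using lipschitz_onD[OF assms, of z y] by (simp add: dist_real_def dist_norm)

lemma lipschitz_on_shift:
  fixes g :: "'a::real_normed_vector \<Rightarrow> real"
  assumes "a-lipschitz_on UNIV g"
  shows "a-lipschitz_on UNIV (\<lambda>z. g (z - y))"
proof (rule lipschitz_onI[OF _ lipschitz_on_nonneg[OF assms]])
  show "dist (g (u - y)) (g (v - y)) \<le> a * dist u v" for u v
    using lipschitz_onD[OF assms, of "u - y" "v - y"] by (simp add: dist_norm)
qed

lemma lipschitz_on_suminf: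
  fixes g :: "nat \<Rightarrow> 'a::real_normed_vector \<Rightarrow> real"
  assumes g: "\<And>i. (a i)-lipschitz_on UNIV (g i)" and a: "summable a"
    and sum: "\<And>z. summable (\<lambda>i. g i z)"
  shows "(suminf a)-lipschitz_on UNIV (\<lambda>z. \<Sum>i. g i z)"
proof (rule lipschitz_onI)
  have le: "(\<Sum>i. g i z) - (\<Sum>i. g i y) \<le> suminf a * dist z y" for z y
  proof -
    have "(\<Sum>i. g i z) - (\<Sum>i. g i y) = (\<Sum>i. g i z - g i y)" by (rule suminf_diff[OF sum sum])
    also have "\<dots> \<le> (\<Sum>i. a i * dist z y)"
      using lipschitz_on_diff_le[OF g]
      by (intro suminf_le summable_diff sum summable_mult2 a) (simp add: dist_norm)
    finally show ?thesis by (simp add: suminf_mult2[OF a])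
  qed
  show "dist (\<Sum>i. g i z) (\<Sum>i. g i y) \<le> suminf a * dist z y" for z y
    using le[of z y] le[of y z] by (simp add: dist_real_def dist_commute abs_le_iff)
  show "0 \<le> suminf a" using a lipschitz_on_nonneg[OF g] by (rule suminf_nonneg)
qed

lemma supergrad_on_shift: "supergrad_on Y g (z - y) \<xi> \<Longrightarrow> supergrad_on Y (\<lambda>u. g (u - y)) z \<xi>"
  by (simp add: supergrad_on_def diff_add_eq)

definition supergrad_error :: "('a::real_normed_vector \<Rightarrow> real) \<Rightarrow> 'a \<Rightarrow> ('a \<Rightarrow>\<^sub>L real) \<Rightarrow> 'a \<Rightarrow> real" where
  "supergrad_error V z \<xi> h = max 0 ((V (z + h) - V z - blinfun_apply \<xi> h) / norm h)"

lemma supergrad_error_nonneg: "0 \<le> supergrad_error V z \<xi> h"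
  by (simp add: supergrad_error_def)

lemma increment_le_supergrad_error:
  "V (z + h) - V z - blinfun_apply \<xi> h \<le> supergrad_error V z \<xi> h * norm h"
  by (cases "h = 0") (simp_all add: supergrad_error_def blinfun.zero_right flip: pos_divide_le_eq)

lemma supergrad_error_le:
  assumes "V (z + h) - V z - blinfun_apply \<xi> h \<le> r * norm h" "0 \<le> r"
  shows "supergrad_error V z \<xi> h \<le> r"
  using assms by (cases "h = 0") (simp_all add: supergrad_error_def pos_divide_le_eq)

lemma supergrad_error_le_lipschitz:
  assumes V: "a-lipschitz_on UNIV V" and \<xi>: "norm \<xi> \<le> a"
  shows "supergrad_error V z \<xi> h \<le> 2 * a"
proof (rule supergrad_error_le)
  show "V (z + h) - V z - blinfun_apply \<xi> h \<le> 2 * a * norm h"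
    using lipschitz_on_diff_le[OF V, of "z + h" z] abs_blinfun_le[OF \<xi>, of h] by simp
qed (use lipschitz_on_nonneg[OF V] in simp)

lemma supergrad_on_iff_error_tendsto:
  "supergrad_on Y V z \<xi> \<longleftrightarrow> (supergrad_error V z \<xi> \<longlongrightarrow> 0) (at 0 within Y)"
proof
  assume super: "supergrad_on Y V z \<xi>"
  show "(supergrad_error V z \<xi> \<longlongrightarrow> 0) (at 0 within Y)"
  proof (rule tendstoI)
    fix r :: real assume r: "0 < r"
    then have "\<forall>\<^sub>F h in at 0 within Y. V (z + h) \<le> V z + blinfun_apply \<xi> h + r / 2 * norm h"
      using super[unfolded supergrad_on_def, rule_format, of "r / 2"] by simp
    then show "\<forall>\<^sub>F h in at 0 within Y. dist (supergrad_error V z \<xi> h) 0 < r"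
    proof eventually_elim
      case (elim h)
      then have "supergrad_error V z \<xi> h \<le> r / 2" using r by (intro supergrad_error_le) linarith+
      then show ?case using r supergrad_error_nonneg[of V z \<xi> h] by (simp add: dist_real_def)
    qed
  qed
next
  assume lim: "(supergrad_error V z \<xi> \<longlongrightarrow> 0) (at 0 within Y)"
  show "supergrad_on Y V z \<xi>"
    unfolding supergrad_on_def
  proof (intro allI impI)
    fix r :: real assume "0 < r"
    from order_tendstoD(2)[OF lim this]
    show "\<forall>\<^sub>F h in at 0 within Y. V (z + h) \<le> V z + blinfun_apply \<xi> h + r * norm h"
    proof eventually_elim
      case (elim h)
      then have "supergrad_error V z \<xi> h * norm h \<le> r * norm h" by (intro mult_right_mono) auto
      then show ?case using increment_le_supergrad_error[of V z h \<xi>] by linarith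
    qed
  qed
qed

lemma supergrad_on_suminf:
  fixes g :: "nat \<Rightarrow> 'a::real_normed_vector \<Rightarrow> real"
  assumes g: "\<And>i. (a i)-lipschitz_on UNIV (g i)" and a: "summable a"
    and sum: "\<And>z. summable (\<lambda>i. g i z)"
    and \<xi>: "\<And>i. norm (\<xi> i) \<le> a i" and super: "\<And>i. supergrad_on Y (g i) z (\<xi> i)"
  shows "supergrad_on Y (\<lambda>z. \<Sum>i. g i z) z (suminf \<xi>)"
proof (cases "at 0 within Y = bot")
  case False
  define E where "E i = supergrad_error (g i) z (\<xi> i)" for i
  have E_bound: "norm (E i h) \<le> 2 * a i" for i h
    using supergrad_error_le_lipschitz[OF g \<xi>] supergrad_error_nonneg[of "g i"] by (simp add: E_def)
  have E_summable: "summable (\<lambda>i. E i h)" for h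
    by (rule summable_comparison_test'[OF summable_mult[OF a] E_bound])
  have E_lim: "(E i \<longlongrightarrow> 0) (at 0 within Y)" for i
    using super unfolding E_def supergrad_on_iff_error_tendsto .
  have "((\<lambda>h. \<Sum>i. E i h) \<longlongrightarrow> (\<Sum>i. 0)) (at 0 within Y)"
    using tannerys_theorem[OF E_lim always_eventually summable_mult[OF a, of 2] False] E_bound
    by auto
  then have E_sum_lim: "((\<lambda>h. \<Sum>i. E i h) \<longlongrightarrow> 0) (at 0 within Y)" by simp
  have "summable (\<lambda>i. norm (\<xi> i))" by (rule summable_comparison_test'[OF a]) (use \<xi> in simp)
  then have \<xi>_summable: "summable \<xi>" by (rule summable_norm_cancel)
  note apply_summable = bounded_linear.summable[OF blinfun.bounded_linear_left \<xi>_summable]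
    and apply_suminf = bounded_linear.suminf[OF blinfun.bounded_linear_left \<xi>_summable]
  have le: "supergrad_error (\<lambda>z. \<Sum>i. g i z) z (suminf \<xi>) h \<le> (\<Sum>i. E i h)" for h
  proof (rule supergrad_error_le)
    have "(\<Sum>i. g i (z + h)) - (\<Sum>i. g i z) - blinfun_apply (suminf \<xi>) h
        = (\<Sum>i. g i (z + h) - g i z - blinfun_apply (\<xi> i) h)"
      by (simp add: apply_suminf suminf_diff sum apply_summable summable_diff)
    also have "\<dots> \<le> (\<Sum>i. E i h * norm h)"
      unfolding E_def
      by (intro suminf_le increment_le_supergrad_error summable_diff summable_mult2 sum apply_summable
          E_summable[unfolded E_def])
    finally show "(\<Sum>i. g i (z + h)) - (\<Sum>i. g i z) - blinfun_apply (suminf \<xi>) h \<le> (\<Sum>i. E i h) * norm h"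
      by (simp add: suminf_mult2[OF E_summable])
    show "0 \<le> (\<Sum>i. E i h)"
      by (rule suminf_nonneg[OF E_summable]) (simp add: E_def supergrad_error_nonneg)
  qed
  show ?thesis
    unfolding supergrad_on_iff_error_tendsto
    by (rule tendsto_sandwich[OF always_eventually always_eventually tendsto_const E_sum_lim])
      (simp_all add: le supergrad_error_nonneg)
qed (simp add: supergrad_on_def)

lemma approximate_minimizer:
  fixes g :: "'a \<Rightarrow> real"
  assumes x: "x \<in> S" and low: "\<And>u. u \<in> S \<Longrightarrow> m \<le> g u" and s: "0 < s"
  obtains x' where "x' \<in> S" "g x' \<le> g x" "\<forall>u\<in>S. g x' \<le> g u + s"
proof -
  have bdd: "bdd_below (g ` S)" using low by (rule bdd_belowI2)
  then obtain v where v: "v \<in> S" "g v < (INF u\<in>S. g u) + s"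
    using cINF_less_iff[OF _ bdd, of "(INF u\<in>S. g u) + s"] x s by auto
  have "g v \<le> g u + s" if "u \<in> S" for u
    using cINF_lower[OF bdd that] v(2) by linarith
  then show thesis using x v(1) by (cases "g x \<le> g v") (force intro: that)+
qed

definition gauge_sum :: "(nat \<Rightarrow> 'a::real_normed_vector \<Rightarrow> real) \<Rightarrow> (nat \<Rightarrow> 'a) \<Rightarrow> nat \<Rightarrow> 'a \<Rightarrow> real" where
  "gauge_sum W x n z = (\<Sum>i\<le>n. W i (z - x i))"

definition gauge_suminf :: "(nat \<Rightarrow> 'a::real_normed_vector \<Rightarrow> real) \<Rightarrow> (nat \<Rightarrow> 'a) \<Rightarrow> 'a \<Rightarrow> real" where
  "gauge_suminf W x z = (\<Sum>i. W i (z - x i))"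

lemma gauge_descent_sequence:
  fixes F :: "'a::real_normed_vector \<Rightarrow> real"
  assumes F: "\<And>u. u \<in> S \<Longrightarrow> 0 \<le> F u" and x0: "x0 \<in> S"
    and W: "\<And>n z. - s n \<le> W n z" and s: "\<And>n. 0 < s n"
  obtains x where "x 0 = x0" "\<forall>n. x n \<in> S"
    "\<forall>n. F (x (Suc n)) + gauge_sum W x n (x (Suc n)) \<le> F (x n) + gauge_sum W x n (x n)"
    "\<forall>n. \<forall>u\<in>S. F (x (Suc n)) + gauge_sum W x n (x (Suc n))
        \<le> F u + gauge_sum W x n u + s n"
proof -
  define P where "P n p \<longleftrightarrow> (case p of (x, T) \<Rightarrow> x \<in> S \<and> (\<exists>m. \<forall>u\<in>S. m \<le> F u + T u) \<and>
    (n = 0 \<longrightarrow> x = x0 \<and> T = (\<lambda>z. W 0 (z - x0))))" for n :: nat and p :: "'a \<times> ('a \<Rightarrow> real)"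
  define Q where "Q n p p' \<longleftrightarrow> (case p of (x, T) \<Rightarrow> case p' of (x', T') \<Rightarrow> F x' + T x' \<le> F x + T x \<and>
    (\<forall>u\<in>S. F x' + T x' \<le> F u + T u + s n) \<and> T' = (\<lambda>z. T z + W (Suc n) (z - x')))"
    for n :: nat and p p' :: "'a \<times> ('a \<Rightarrow> real)"
  have "\<exists>p. \<forall>n. P n (p n) \<and> Q n (p n) (p (Suc n))"
  proof (rule dependent_nat_choice)
    have "- s 0 \<le> F u + W 0 (u - x0)" if "u \<in> S" for u
      using F[OF that] W[of 0 "u - x0"] by simp
    then show "\<exists>p. P 0 p" using x0 by (intro exI[of _ "(x0, \<lambda>z. W 0 (z - x0))"]) (auto simp: P_def)
  next
    fix p n assume "P n p"
    then obtain x T m where p: "p = (x, T)" "x \<in> S" and m: "\<forall>u\<in>S. m \<le> F u + T u"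
      by (auto simp: P_def)
    obtain x' where x': "x' \<in> S" "F x' + T x' \<le> F x + T x" "\<forall>u\<in>S. F x' + T x' \<le> F u + T u + s n"
      using approximate_minimizer[OF p(2), of m "\<lambda>u. F u + T u" "s n"] m s by blast
    define T' where "T' = (\<lambda>z. T z + W (Suc n) (z - x'))"
    have "m - s (Suc n) \<le> F u + T' u" if "u \<in> S" for u
      using m that W[of "Suc n" "u - x'"] unfolding T'_def by force
    then have "P (Suc n) (x', T')" using x'(1) by (auto simp: P_def)
    moreover have "Q n p (x', T')" using x' by (simp add: Q_def p(1) T'_def)
    ultimately show "\<exists>p'. P (Suc n) p' \<and> Q n p p'" by blast
  qed
  then obtain p where p: "\<And>n. P n (p n)" "\<And>n. Q n (p n) (p (Suc n))" by blast
  define x where "x n = fst (p n)" for n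
  have T: "snd (p n) = gauge_sum W x n" for n
  proof (induction n)
    case 0
    show ?case using p(1)[of 0] by (auto simp: P_def x_def gauge_sum_def fun_eq_iff)
  next
    case (Suc n)
    then show ?case using p(2)[of n]
      by (auto simp: Q_def x_def gauge_sum_def fun_eq_iff split: prod.splits)
  qed
  have x_in: "x n \<in> S" and x_0: "n = 0 \<Longrightarrow> x n = x0" for n
    using p(1)[of n] by (auto simp: P_def x_def split: prod.splits)
  have "F (x (Suc n)) + gauge_sum W x n (x (Suc n)) \<le> F (x n) + gauge_sum W x n (x n) \<and>
      (\<forall>u\<in>S. F (x (Suc n)) + gauge_sum W x n (x (Suc n)) \<le> F u + gauge_sum W x n u + s n)" for n
    using p(2)[of n] T[of n] by (auto simp: Q_def x_def split: prod.splits)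
  then show thesis using x_in x_0 by (intro that[of x]) auto
qed

locale gauge_descent =
  fixes S :: "'a::banach set" and F :: "'a \<Rightarrow> real" and W :: "nat \<Rightarrow> 'a \<Rightarrow> real" and a s :: "nat \<Rightarrow> real"
    and x :: "nat \<Rightarrow> 'a"
  assumes closed_epigraph: "closed (epigraph S F)"
    and gauge: "\<And>n. norm_gauge (a n) (s n) (W n)" and a_pos: "\<And>n. 0 < a n"
    and a_summable: "summable a" and s_summable: "summable s"
    and ratio_summable: "summable (\<lambda>n. (s n + s (Suc n)) / a (Suc n))"
    and x_in: "\<And>n. x n \<in> S"
    and descent: "\<And>n. F (x (Suc n)) + gauge_sum W x n (x (Suc n)) \<le> F (x n) + gauge_sum W x n (x n)"
    and approx: "\<And>n u. u \<in> S \<Longrightarrow> F (x (Suc n)) + gauge_sum W x n (x (Suc n))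
        \<le> F u + gauge_sum W x n u + s n"
begin

lemma gauge_sum_Suc: "gauge_sum W x (Suc n) z = gauge_sum W x n z + W (Suc n) (z - x (Suc n))"
  by (simp add: gauge_sum_def)

lemma step_le: "norm (x (Suc (Suc n)) - x (Suc n)) \<le> (s n + s (Suc n)) / a (Suc n)"
proof -
  have "W (Suc n) (x (Suc (Suc n)) - x (Suc n)) \<le> s n"
    using descent[of "Suc n"] approx[OF x_in[of "Suc (Suc n)"], of n]
      norm_gauge_zero[OF gauge[of "Suc n"]]
    by (simp add: gauge_sum_Suc)
  then have "a (Suc n) * norm (x (Suc (Suc n)) - x (Suc n)) \<le> s n + s (Suc n)"
    using norm_gauge_lower[OF gauge, of "Suc n" "x (Suc (Suc n)) - x (Suc n)"] by linarith
  then show ?thesis using a_pos[of "Suc n"] by (simp add: pos_le_divide_eq mult.commute)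
qed

lemma x_convergent: "convergent x"
proof -
  have "summable (\<lambda>n. x (Suc (Suc n)) - x (Suc n))"
    by (rule summable_comparison_test'[OF ratio_summable step_le])
  then have "convergent (\<lambda>n. \<Sum>i<n. x (Suc (Suc i)) - x (Suc i))"
    by (simp add: summable_iff_convergent)
  then have "convergent (\<lambda>n. x (Suc n) - x (Suc 0))"
    by (simp only: sum_lessThan_telescope[of "\<lambda>n. x (Suc n)"])
  then have "convergent (\<lambda>n. x (Suc n))" by (simp add: convergent_diff_const_right_iff)
  then show ?thesis by (simp add: convergent_Suc_iff)
qed

lemma gauge_summable: "summable (\<lambda>i. W i (z - x i))"
proof -
  obtain B where B: "\<And>n. norm (x n) \<le> B"
    using convergent_imp_Bseq[OF x_convergent] by (auto simp: Bseq_def)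
  show ?thesis
  proof (rule summable_comparison_test')
    show "summable (\<lambda>i. a i * (norm z + B) + s i)"
      by (intro summable_add summable_mult2 a_summable s_summable)
    show "norm (W i (z - x i)) \<le> a i * (norm z + B) + s i" for i
    proof -
      have "norm (z - x i) \<le> norm z + B" using norm_triangle_ineq4[of z "x i"] B[of i] by simp
      then have "a i * norm (z - x i) \<le> a i * (norm z + B)"
        using a_pos[of i] by (intro mult_left_mono) auto
      moreover have "0 \<le> a i * norm (z - x i)" using a_pos[of i] by simp
      moreover have "0 \<le> s i" using norm_gauge_ge[OF gauge, of i 0] norm_gauge_zero[OF gauge, of i]
        by simp
      ultimately show ?thesis
        using norm_gauge_upper[OF gauge, of i "z - x i"] norm_gauge_ge[OF gauge, of i "z - x i"]
        by (simp add: abs_le_iff)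
    qed
  qed
qed

lemma gauge_sum_tendsto: "(\<lambda>n. gauge_sum W x n z) \<longlonglongrightarrow> gauge_suminf W x z"
  unfolding gauge_sum_def gauge_suminf_def by (rule summable_LIMSEQ'[OF gauge_summable])

lemma gauge_sum_diff_le: "gauge_sum W x n z - gauge_sum W x n y \<le> suminf a * norm (z - y)"
proof -
  have "gauge_sum W x n z - gauge_sum W x n y = (\<Sum>i\<le>n. W i (z - x i) - W i (y - x i))"
    by (simp add: gauge_sum_def sum_subtractf)
  also have "\<dots> \<le> (\<Sum>i\<le>n. a i * norm (z - y))"
    by (intro sum_mono lipschitz_on_diff_le[OF lipschitz_on_shift[OF norm_gauge_lipschitz[OF gauge]]])
  also have "\<dots> \<le> suminf a * norm (z - y)"
    unfolding sum_distrib_right[symmetric] using a_pos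
    by (intro mult_right_mono sum_le_suminf a_summable) (auto intro: less_imp_le)
  finally show ?thesis .
qed

lemma limit_in_epigraph:
  assumes x: "x \<longlonglongrightarrow> l" and b: "\<And>n. F (x (Suc n)) + gauge_sum W x (Suc n) (x (Suc n)) \<le> b n" "b \<longlonglongrightarrow> \<beta>"
  shows "(l, \<beta> - gauge_suminf W x l) \<in> epigraph S F"
proof -
  define B where "B n = b n - gauge_sum W x (Suc n) l + suminf a * norm (l - x (Suc n))" for n
  have "(x (Suc n), B n) \<in> epigraph S F" for n
    using b(1)[of n] gauge_sum_diff_le[of "Suc n" l "x (Suc n)"] x_in
    by (simp add: mem_epigraph B_def)
  moreover have "(\<lambda>n. (x (Suc n), B n)) \<longlonglongrightarrow> (l, \<beta> - gauge_suminf W x l + suminf a * norm (l - l))"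
    unfolding B_def by (intro tendsto_intros LIMSEQ_Suc x b(2) LIMSEQ_Suc[OF gauge_sum_tendsto])
  ultimately have "(l, \<beta> - gauge_suminf W x l + suminf a * norm (l - l)) \<in> epigraph S F"
    by (rule closed_sequentially[OF closed_epigraph])
  then show ?thesis by simp
qed

lemma gauge_sum_descent:
  "F (x (Suc n)) + gauge_sum W x (Suc n) (x (Suc n)) \<le> F (x (Suc n)) + gauge_sum W x n (x (Suc n))"
  using norm_gauge_zero[OF gauge, of "Suc n"] by (simp add: gauge_sum_Suc)

lemma limit_minimizes_at:
  assumes x: "x \<longlonglongrightarrow> l" and u: "u \<in> S"
  shows "F l + gauge_suminf W x l \<le> F u + gauge_suminf W x u"
proof -
  have le: "F (x (Suc n)) + gauge_sum W x (Suc n) (x (Suc n)) \<le> F u + gauge_sum W x n u + s n" for n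
    using gauge_sum_descent[of n] approx[OF u, of n] by simp
  have "(\<lambda>n. F u + gauge_sum W x n u + s n) \<longlonglongrightarrow> F u + gauge_suminf W x u + 0"
    by (intro tendsto_intros gauge_sum_tendsto summable_LIMSEQ_zero[OF s_summable])
  from limit_in_epigraph[OF x le this] show ?thesis by (simp add: mem_epigraph)
qed

lemma limit_le_start:
  assumes x: "x \<longlonglongrightarrow> l"
  shows "l \<in> S" and "F l + gauge_suminf W x l \<le> F (x 0)"
proof -
  have "F (x n) + gauge_sum W x n (x n) \<le> F (x 0)" for n
  proof (induction n)
    case 0
    show ?case using norm_gauge_zero[OF gauge, of 0] by (simp add: gauge_sum_def)
  next
    case (Suc n)
    then show ?case using gauge_sum_descent[of n] descent[of n] by simp
  qed
  from limit_in_epigraph[OF x this tendsto_const]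
  show "l \<in> S" and "F l + gauge_suminf W x l \<le> F (x 0)" by (simp_all add: mem_epigraph)
qed

lemma limit_is_arg_min:
  assumes "x \<longlonglongrightarrow> l"
  shows "is_arg_min (\<lambda>u. F u + gauge_suminf W x u) (\<lambda>u. u \<in> S) l"
  using limit_le_start(1)[OF assms] limit_minimizes_at[OF assms] by (simp add: is_arg_min_linorder)

lemma gauge_suminf_lower: "a 0 * norm (z - x 0) - suminf s \<le> gauge_suminf W x z"
proof -
  have "(\<lambda>i. (if i = 0 then a 0 * norm (z - x 0) else 0) - s i)
      sums (a 0 * norm (z - x 0) - suminf s)"
    using sums_diff[OF sums_single[of 0 "\<lambda>_. a 0 * norm (z - x 0)"] summable_sums[OF s_summable]]
    by simp
  moreover have "(\<lambda>i. W i (z - x i)) sums gauge_suminf W x z"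
    unfolding gauge_suminf_def by (rule summable_sums[OF gauge_summable])
  ultimately show ?thesis
    by (rule sums_le[rotated])
      (use norm_gauge_lower[OF gauge] norm_gauge_ge[OF gauge] in auto)
qed

end

text \<open>The scale \<open>a n\<close> is geometric with total \<open>c < \<kappa>\<close>, and its first term \<open>b\<close> still exceeds
  \<open>F x0 / \<rho>\<close>; the errors \<open>s n\<close> decay faster, so that the steps are summable.\<close>

lemma gauge_scales_exist:
  fixes M \<kappa> \<rho> :: real
  assumes "0 \<le> M" "M < \<kappa> * \<rho>" "0 < \<rho>"
  obtains a s :: "nat \<Rightarrow> real" where "\<forall>n. 0 < a n" "\<forall>n. 0 < s n" "summable a" "summable s"
    "summable (\<lambda>n. (s n + s (Suc n)) / a (Suc n))" "suminf a < \<kappa>" "M + suminf s < a 0 * \<rho>"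
proof -
  have "M / \<rho> < \<kappa>" using assms by (simp add: pos_divide_less_eq)
  then obtain c where c: "M / \<rho> < c" "c < \<kappa>" using dense by blast
  then obtain b where b: "M / \<rho> < b" "b < c" using dense by blast
  have b_pos: "0 < b" using b(1) assms by (meson divide_nonneg_pos le_less_trans)
  have M_less: "M < b * \<rho>" using b(1) assms(3) by (simp add: pos_divide_less_eq)
  define r where "r = 1 - b / c"
  have r: "0 < r" "r < 1" "b / (1 - r) = c" using b(2) b_pos by (simp_all add: r_def)
  define \<sigma> where "\<sigma> = (b * \<rho> - M) / 3"
  have \<sigma>: "0 < \<sigma>" using M_less by (simp add: \<sigma>_def)
  define a where "a n = b * r ^ n" for n :: nat
  define s where "s n = \<sigma> * (r / 2) ^ n" for n :: nat
  have a_sums: "a sums c"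
    using sums_mult[OF geometric_sums[of r], of b] r by (simp add: a_def[abs_def])
  have s_sums: "s sums (\<sigma> * (1 / (1 - r / 2)))"
    unfolding s_def[abs_def] using r by (intro sums_mult geometric_sums) simp
  show thesis
  proof (rule that[of a s])
    show "\<forall>n. 0 < a n" "\<forall>n. 0 < s n" using b_pos r(1) \<sigma> by (simp_all add: a_def s_def)
    show "summable a" "summable s" using a_sums s_sums by (simp_all add: sums_iff)
    show "suminf a < \<kappa>" using sums_unique[OF a_sums] c(2) by simp
    have "(s n + s (Suc n)) / a (Suc n) = \<sigma> * (1 + r / 2) / (b * r) * (1 / 2) ^ n" for n
      using r(1) b_pos
      by (simp add: s_def a_def power_divide divide_simps) (simp add: algebra_simps)
    then show "summable (\<lambda>n. (s n + s (Suc n)) / a (Suc n))"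
      by (simp add: summable_mult summable_geometric)
    have "1 / (1 - r / 2) \<le> 2" using r by (simp add: divide_simps)
    then have "\<sigma> * (1 / (1 - r / 2)) \<le> \<sigma> * 2" using \<sigma> by (intro mult_left_mono) auto
    then show "M + suminf s < a 0 * \<rho>"
      using sums_unique[OF s_sums] \<sigma> by (simp add: a_def) (simp add: \<sigma>_def field_simps)
  qed
qed

lemma gauge_variational_principle:
  fixes S :: "'a::banach set" and V :: "real \<Rightarrow> real \<Rightarrow> 'a \<Rightarrow> real"
  assumes closed_epigraph: "closed (epigraph S F)" and F: "\<And>u. u \<in> S \<Longrightarrow> 0 \<le> F u"
    and x0: "x0 \<in> S" "F x0 < \<kappa> * \<rho>" and \<rho>: "0 < \<rho>"
    and V: "\<And>a s. 0 < a \<Longrightarrow> 0 < s \<Longrightarrow> norm_gauge a s (V a s)"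
  obtains a s x l where "\<forall>n. 0 < a n" "\<forall>n. 0 < s n" "summable a" "suminf a < \<kappa>"
    "\<forall>n. x n \<in> S" "\<forall>z. summable (\<lambda>n. V (a n) (s n) (z - x n))"
    "is_arg_min (\<lambda>u. F u + gauge_suminf (\<lambda>n. V (a n) (s n)) x u) (\<lambda>u. u \<in> S) l"
    "F l < \<kappa> * (\<rho> - norm (l - x0))"
proof -
  obtain a s :: "nat \<Rightarrow> real" where pos: "\<forall>n. 0 < a n" "\<forall>n. 0 < s n" and a: "summable a"
    and s: "summable s" and ratio: "summable (\<lambda>n. (s n + s (Suc n)) / a (Suc n))"
    and a_less: "suminf a < \<kappa>" and start: "F x0 + suminf s < a 0 * \<rho>"
    by (rule gauge_scales_exist[OF F[OF x0(1)] x0(2) \<rho>])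
  define W where "W = (\<lambda>n. V (a n) (s n))"
  have W: "norm_gauge (a n) (s n) (W n)" for n unfolding W_def using pos by (intro V) auto
  obtain x where x: "x 0 = x0" "\<forall>n. x n \<in> S"
    and descent: "\<forall>n. F (x (Suc n)) + gauge_sum W x n (x (Suc n)) \<le> F (x n) + gauge_sum W x n (x n)"
    and approx: "\<forall>n. \<forall>u\<in>S. F (x (Suc n)) + gauge_sum W x n (x (Suc n))
        \<le> F u + gauge_sum W x n u + s n"
    by (rule gauge_descent_sequence[OF F x0(1) norm_gauge_ge[OF W] spec[OF pos(2)]])
  interpret gauge_descent S F W a s x
    by unfold_locales (simp_all add: closed_epigraph W pos a s ratio x(2) descent approx)
  obtain l where l: "x \<longlonglongrightarrow> l" using x_convergent by (auto simp: convergent_def)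
  have less: "F l < a 0 * (\<rho> - norm (l - x0))"
    using limit_le_start(2)[OF l] gauge_suminf_lower[of l] start x(1)
    by (simp add: right_diff_distrib)
  have "sum a {0} \<le> suminf a" using pos(1) by (intro sum_le_suminf a) (auto simp: less_imp_le)
  then have "a 0 < \<kappa>" using a_less by simp
  moreover have "0 < a 0 * (\<rho> - norm (l - x0))" using less F[OF limit_le_start(1)[OF l]] by simp
  then have "0 < \<rho> - norm (l - x0)" using spec[OF pos(1), of 0] by (simp add: zero_less_mult_iff)
  ultimately have "a 0 * (\<rho> - norm (l - x0)) < \<kappa> * (\<rho> - norm (l - x0))"
    by (rule mult_strict_right_mono)
  with less have F_l: "F l < \<kappa> * (\<rho> - norm (l - x0))" by simp
  show thesis
    by (rule that[OF pos a a_less x(2) _ _ F_l])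
      (use gauge_summable limit_is_arg_min[OF l] in \<open>simp_all add: W_def\<close>)
qed

section \<open>Separable reduction\<close>

definition subgrad_on :: "'a::real_normed_vector set \<Rightarrow> ('a \<Rightarrow> ereal) \<Rightarrow> 'a \<Rightarrow> ('a \<Rightarrow>\<^sub>L real) \<Rightarrow> bool" where
  "subgrad_on Y f x x' \<longleftrightarrow>
    (\<forall>r>0. \<forall>\<^sub>F h in at 0 within Y. f x + ereal (blinfun_apply x' h - r * norm h) \<le> f (x + h))"

lemma subgrad_on_iff_radii:
  "subgrad_on Y f x x' \<longleftrightarrow> (\<exists>R. \<forall>k. 0 < R k \<and> (\<forall>h\<in>Y. norm h < R k \<longrightarrow>
    f x + ereal (blinfun_apply x' h - norm h / real (Suc k)) \<le> f (x + h)))"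
  (is "_ \<longleftrightarrow> (\<exists>R. \<forall>k. ?radius (R k) k)")
proof
  assume sub: "subgrad_on Y f x x'"
  have "\<exists>R. ?radius R k" for k
  proof -
    have "\<forall>\<^sub>F h in at 0 within Y. f x + ereal (blinfun_apply x' h - norm h / real (Suc k)) \<le> f (x + h)"
      using sub[unfolded subgrad_on_def, rule_format, of "1 / real (Suc k)"] by simp
    then obtain R where "0 < R" and R: "\<forall>h\<in>Y. h \<noteq> 0 \<and> dist h 0 < R \<longrightarrow>
        f x + ereal (blinfun_apply x' h - norm h / real (Suc k)) \<le> f (x + h)"
      unfolding eventually_at by blast
    moreover have "f x + ereal (blinfun_apply x' h - norm h / real (Suc k)) \<le> f (x + h)" if "h = 0"
      for h
      using that by (simp add: blinfun.zero_right zero_ereal_def[symmetric])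
    ultimately show ?thesis by (intro exI[of _ R]) auto
  qed
  then show "\<exists>R. \<forall>k. ?radius (R k) k" by (intro choice) blast
next
  assume "\<exists>R. \<forall>k. ?radius (R k) k"
  then obtain R where R: "?radius (R k) k" for k by blast
  show "subgrad_on Y f x x'"
    unfolding subgrad_on_def
  proof (intro allI impI)
    fix r :: real assume "0 < r"
    then obtain k where k: "inverse (real (Suc k)) < r" using reals_Archimedean by blast
    have "f x + ereal (blinfun_apply x' h - r * norm h) \<le> f (x + h)" if "h \<in> Y" "norm h < R k" for h
    proof -
      have "norm h / real (Suc k) \<le> r * norm h"
        using mult_right_mono[OF less_imp_le[OF k] norm_ge_zero[of h]] by (simp add: field_simps)
      then have "f x + ereal (blinfun_apply x' h - r * norm h)
          \<le> f x + ereal (blinfun_apply x' h - norm h / real (Suc k))"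
        by (intro add_left_mono) simp
      also have "\<dots> \<le> f (x + h)" using R[of k] that by blast
      finally show ?thesis .
    qed
    then show "\<forall>\<^sub>F h in at 0 within Y. f x + ereal (blinfun_apply x' h - r * norm h) \<le> f (x + h)"
      using R[of k] by (auto simp: eventually_at intro!: exI[of _ "R k"])
  qed
qed

lemma countable_closed_under_binary:
  fixes G :: "'a \<Rightarrow> 'a \<Rightarrow> 'a set"
  assumes "\<And>u v. countable (G u v)"
  obtains C where "countable C" "x \<in> C" "\<forall>u\<in>C. \<forall>v\<in>C. G u v \<subseteq> C"
proof -
  define step where "step C = C \<union> (\<Union>u\<in>C. \<Union>v\<in>C. G u v)" for C
  define D where "D n = (step ^^ n) {x}" for n
  have D_0: "D 0 = {x}" and D_Suc: "D (Suc n) = step (D n)" for n by (simp_all add: D_def)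
  have mono: "D m \<subseteq> D n" if "m \<le> n" for m n
    using that by (rule lift_Suc_mono_le[rotated]) (auto simp: D_Suc step_def)
  have "countable (D n)" for n
    by (induction n) (auto simp: D_0 D_Suc step_def assms intro!: countable_UN)
  moreover have "G u v \<subseteq> (\<Union>n. D n)" if uv: "u \<in> (\<Union>n. D n)" "v \<in> (\<Union>n. D n)" for u v
  proof -
    obtain m n where "u \<in> D m" "v \<in> D n" using uv by blast
    then have "u \<in> D (max m n)" "v \<in> D (max m n)" using mono[of m "max m n"] mono[of n "max m n"]
      by auto
    then have "G u v \<subseteq> D (Suc (max m n))" by (auto simp: D_Suc step_def)
    then show ?thesis by blast
  qed
  ultimately show thesis using D_0 by (intro that[of "\<Union>n. D n"]) auto
qed

lemma subspace_closure_rational: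
  fixes C :: "'a::real_normed_vector set"
  assumes ne: "C \<noteq> {}"
    and C: "\<And>u v p q. u \<in> C \<Longrightarrow> v \<in> C \<Longrightarrow> p \<in> \<rat> \<Longrightarrow> q \<in> \<rat> \<Longrightarrow> p *\<^sub>R u + q *\<^sub>R v \<in> C"
  shows "subspace (closure C)"
proof -
  have "(\<lambda>(u, v). u + v) ` closure (C \<times> C) \<subseteq> closure C"
    using C[of _ _ 1 1] closure_subset[of C]
    by (intro image_closure_subset) (force simp: case_prod_beta intro!: continuous_intros)+
  then have add: "u + v \<in> closure C" if "u \<in> closure C" "v \<in> closure C" for u v
    using that by (auto simp: closure_Times)
  have "(\<lambda>(r, u). r *\<^sub>R u) ` closure (\<rat> \<times> C) \<subseteq> closure C"
    using C[of _ _ _ 0] closure_subset[of C]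
    by (intro image_closure_subset) (force simp: case_prod_beta intro!: continuous_intros)+
  then have scale: "r *\<^sub>R u \<in> closure C" if "u \<in> closure C" for r :: real and u
    using that by (auto simp: closure_Times Rats_closure_real)
  obtain u where "u \<in> closure C" using ne closure_subset by blast
  then have "0 \<in> closure C" using scale[of u 0] by simp
  then show ?thesis using add scale by (simp add: subspace_def)
qed

text \<open>The Frechet subgradients of \<open>f\<close> at \<open>v\<close> are the functionals that lie, up to the constant \<open>f v\<close>,
  below these sets for all initial segments \<open>rs\<close> of some sequence of positive radii.\<close>

definition perturbed_epigraph ::
  "('a::real_normed_vector \<Rightarrow> ereal) \<Rightarrow> real list \<Rightarrow> 'a \<Rightarrow> ('a \<times> real) set" where
  "perturbed_epigraph f rs v =
    {(h, s). \<exists>k<length rs. norm h < rs ! k \<and> f (v + h) + ereal (norm h / real (Suc k)) \<le> ereal s}"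

lemma perturbed_epigraph_translate:
  assumes hs: "(h, s) \<in> perturbed_epigraph f rs x" and z: "norm z \<le> \<mu>"
    and len: "length rs' = length rs" and rs: "\<And>k. k < length rs \<Longrightarrow> rs ! k + \<mu> \<le> rs' ! k"
  shows "(z + h, \<mu> + s) \<in> perturbed_epigraph f rs' (x - z)"
proof -
  obtain k where k: "k < length rs" "norm h < rs ! k"
    "f (x + h) + ereal (norm h / real (Suc k)) \<le> ereal s"
    using hs by (auto simp: perturbed_epigraph_def)
  have norm_le: "norm (z + h) \<le> \<mu> + norm h" using norm_triangle_ineq[of z h] z by simp
  have "0 \<le> \<mu>" using z norm_ge_zero order.trans by blast
  then have "\<mu> / real (Suc k) \<le> \<mu>" by (simp add: divide_le_eq mult_nonneg_nonneg algebra_simps)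
  then have "norm (z + h) / real (Suc k) \<le> \<mu> + norm h / real (Suc k)"
    using divide_right_mono[OF norm_le, of "real (Suc k)"] unfolding add_divide_distrib by linarith
  then have "f (x + h) + ereal (norm (z + h) / real (Suc k))
      \<le> ereal \<mu> + (f (x + h) + ereal (norm h / real (Suc k)))"
    by (cases "f (x + h)") auto
  also have "\<dots> \<le> ereal \<mu> + ereal s" using k(3) by (rule add_left_mono)
  finally have "f (x - z + (z + h)) + ereal (norm (z + h) / real (Suc k)) \<le> ereal (\<mu> + s)" by simp
  moreover have "norm (z + h) < rs' ! k" using norm_le k(2) rs[OF k(1)] by linarith
  ultimately show ?thesis using k(1) len by (auto simp: perturbed_epigraph_def)
qed

definition descends_below :: "real \<Rightarrow> real \<Rightarrow> ('a::real_normed_vector \<times> real) set \<Rightarrow> bool" where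
  "descends_below K \<beta> A \<longleftrightarrow> (\<exists>(h, s)\<in>convex hull A. s + K * norm h < \<beta>)"

lemma descends_below_mono: "descends_below K \<beta> A \<Longrightarrow> A \<subseteq> B \<Longrightarrow> descends_below K \<beta> B"
  unfolding descends_below_def using hull_mono[of A B convex] by blast

lemma descends_below_finite_support:
  assumes "descends_below K \<beta> A"
  obtains T where "finite T" "T \<subseteq> A" "descends_below K \<beta> T"
proof -
  obtain e where e: "e \<in> convex hull A" "snd e + K * norm (fst e) < \<beta>"
    using assms by (auto simp: descends_below_def)
  obtain T u where T: "finite T" "T \<subseteq> A" "\<forall>x\<in>T. 0 \<le> u x" "sum u T = 1" "(\<Sum>v\<in>T. u v *\<^sub>R v) = e"
    using e(1) unfolding convex_hull_explicit by blast
  then have "e \<in> convex hull T" by (auto simp: convex_hull_finite)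
  with e(2) have "descends_below K \<beta> T" by (auto simp: descends_below_def)
  with T(1,2) show thesis by (rule that)
qed

lemma descends_below_translate:
  assumes Y: "subspace Y" and descends: "descends_below K \<beta> (perturbed_epigraph f rs x \<inter> Y \<times> UNIV)"
    and z: "z \<in> Y" "norm z \<le> \<mu>" and K: "0 \<le> K"
    and len: "length rs' = length rs" and rs: "\<And>k. k < length rs \<Longrightarrow> rs ! k + \<mu> \<le> rs' ! k"
  shows "descends_below K (\<beta> + (1 + K) * \<mu>) (perturbed_epigraph f rs' (x - z) \<inter> Y \<times> UNIV)"
proof -
  obtain h s where hs: "(h, s) \<in> convex hull (perturbed_epigraph f rs x \<inter> Y \<times> UNIV)"
    "s + K * norm h < \<beta>"
    using descends by (auto simp: descends_below_def)
  have "(z, \<mu>) + (h, s) \<in> convex hull ((+) (z, \<mu>) ` (perturbed_epigraph f rs x \<inter> Y \<times> UNIV))"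
    using hs(1) by (simp only: convex_hull_translation image_eqI)
  also have "\<dots> \<subseteq> convex hull (perturbed_epigraph f rs' (x - z) \<inter> Y \<times> UNIV)"
    using perturbed_epigraph_translate[OF _ z(2) len rs] subspace_add[OF Y z(1)]
    by (intro hull_mono) auto
  finally have "(z + h, \<mu> + s) \<in> convex hull (perturbed_epigraph f rs' (x - z) \<inter> Y \<times> UNIV)" by simp
  moreover have "K * norm (z + h) \<le> K * (\<mu> + norm h)"
    using norm_triangle_ineq[of z h] z(2) K by (intro mult_left_mono) auto
  then have "\<mu> + s + K * norm (z + h) < \<beta> + (1 + K) * \<mu>" using hs(2) by (simp add: algebra_simps)
  ultimately show ?thesis unfolding descends_below_def by blast
qed

text \<open>Rational radii and levels leave only countably many conditions to be met by a countable \<open>C\<close>.\<close>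

definition descent_rich :: "('a::real_normed_vector \<Rightarrow> ereal) \<Rightarrow> real \<Rightarrow> 'a set \<Rightarrow> bool" where
  "descent_rich f K C \<longleftrightarrow> (\<forall>v\<in>C. \<forall>rs\<in>lists \<rat>. \<forall>\<beta>\<in>\<rat>.
    descends_below K \<beta> (perturbed_epigraph f rs v) \<longrightarrow>
    descends_below K \<beta> (perturbed_epigraph f rs v \<inter> C \<times> UNIV))"

lemma descent_rich_set_exists:
  fixes f :: "'a::real_normed_vector \<Rightarrow> ereal"
  obtains C where "countable C" "x0 \<in> C" "subspace (closure C)" "descent_rich f K C"
proof -
  define T where "T v rs \<beta> = (SOME T. finite T \<and> T \<subseteq> perturbed_epigraph f rs v \<and>
    (descends_below K \<beta> (perturbed_epigraph f rs v) \<longrightarrow> descends_below K \<beta> T))" for v rs \<beta>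
  have "\<exists>T. finite T \<and> T \<subseteq> A \<and> (descends_below K \<beta> A \<longrightarrow> descends_below K \<beta> T)"
    for \<beta> and A :: "('a \<times> real) set"
    using descends_below_finite_support[of K \<beta> A] by (metis empty_subsetI finite.emptyI)
  from someI_ex[OF this] have T: "finite (T v rs \<beta>)" "T v rs \<beta> \<subseteq> perturbed_epigraph f rs v"
    "descends_below K \<beta> (perturbed_epigraph f rs v) \<Longrightarrow> descends_below K \<beta> (T v rs \<beta>)" for v rs \<beta>
    unfolding T_def by blast+
  define G where "G u v = (\<Union>p\<in>\<rat>. \<Union>q\<in>\<rat>. {p *\<^sub>R u + q *\<^sub>R v}) \<union> (\<Union>rs\<in>lists \<rat>. \<Union>\<beta>\<in>\<rat>. fst ` T u rs \<beta>)"
    for u v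
  have "countable (G u v)" for u v
    unfolding G_def using T(1)
    by (intro countable_Un countable_UN countable_lists countable_rat)
      (auto intro: countable_finite)
  then obtain C where C: "countable C" "x0 \<in> C" "\<forall>u\<in>C. \<forall>v\<in>C. G u v \<subseteq> C"
    by (rule countable_closed_under_binary)
  have "p *\<^sub>R u + q *\<^sub>R v \<in> C" if "u \<in> C" "v \<in> C" "p \<in> \<rat>" "q \<in> \<rat>" for u v p q
  proof -
    have "p *\<^sub>R u + q *\<^sub>R v \<in> G u v" using that(3,4) by (auto simp: G_def)
    then show ?thesis using C(3) that(1,2) by blast
  qed
  then have "subspace (closure C)" using C(2) by (intro subspace_closure_rational) auto
  moreover have "descent_rich f K C"
    unfolding descent_rich_def
  proof (intro ballI impI)
    fix v rs \<beta> assume v: "v \<in> C" "rs \<in> lists \<rat>" "\<beta> \<in> (\<rat> :: real set)"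
      and descends: "descends_below K \<beta> (perturbed_epigraph f rs v)"
    have "fst ` T v rs \<beta> \<subseteq> G v v" unfolding G_def using v(2,3)
      by (intro le_supI2 SUP_upper2[of rs] SUP_upper2[of \<beta>]) auto
    then have "fst ` T v rs \<beta> \<subseteq> C" using C(3) v(1) by blast
    then have "T v rs \<beta> \<subseteq> perturbed_epigraph f rs v \<inter> C \<times> UNIV" using T(2)[of v rs \<beta>] by fastforce
    with T(3)[OF descends] show "descends_below K \<beta> (perturbed_epigraph f rs v \<inter> C \<times> UNIV)"
      by (rule descends_below_mono)
  qed
  ultimately show thesis using C(1,2) by (intro that)
qed

lemma convex_UN_incseq:
  fixes A :: "nat \<Rightarrow> 'a::real_vector set"
  assumes "incseq A" "\<And>n. convex (A n)"
  shows "convex (\<Union>n. A n)"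
proof (rule convexI)
  fix x y and u v :: real
  assume "x \<in> (\<Union>n. A n)" "y \<in> (\<Union>n. A n)" and uv: "0 \<le> u" "0 \<le> v" "u + v = 1"
  then obtain m n where "x \<in> A m" "y \<in> A n" by blast
  then have "x \<in> A (max m n)" "y \<in> A (max m n)"
    using incseqD[OF assms(1), of m "max m n"] incseqD[OF assms(1), of n "max m n"] by auto
  then have "u *\<^sub>R x + v *\<^sub>R y \<in> A (max m n)" using assms(2) uv by (intro convexD)
  then show "u *\<^sub>R x + v *\<^sub>R y \<in> (\<Union>n. A n)" by blast
qed

lemma subgradient_if_not_descends_below:
  fixes f :: "'a::real_normed_vector \<Rightarrow> ereal"
  assumes f: "\<And>x. f x \<noteq> -\<infinity>" "f x = ereal a" and K: "0 \<le> K" and R: "\<And>k. 0 < R k"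
    and no_descent: "\<And>n. \<not> descends_below K a (perturbed_epigraph f (map R [0..<n]) x)"
  obtains x' where "norm x' \<le> K" "subgrad_on UNIV f x x'"
proof -
  define A where "A n = perturbed_epigraph f (map R [0..<n]) x" for n
  define E where "E = (\<Union>n. (+) (0, - a) ` (convex hull A n))"
  have "A m \<subseteq> A n" if "m \<le> n" for m n
    using that by (force simp: A_def perturbed_epigraph_def)
  then have "convex E"
    unfolding E_def
    by (intro convex_UN_incseq incseq_SucI image_mono hull_mono
        convex_translation convex_convex_hull) simp
  moreover have "0 \<le> s + K * norm h" if "(h, s) \<in> E" for h s
    using that no_descent by (force simp: E_def A_def descends_below_def not_less)
  ultimately obtain x' where x': "norm x' \<le> K" "\<And>h s. (h, s) \<in> E \<Longrightarrow> blinfun_apply x' h \<le> s"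
    using hahn_banach_convex[OF _ K] by blast
  have "f x + ereal (blinfun_apply x' h - norm h / real (Suc k)) \<le> f (x + h)" if h: "norm h < R k"
    for h k
  proof (cases "f (x + h)")
    case (real t)
    have "(h, t + norm h / real (Suc k)) \<in> A (Suc k)"
      using h real by (auto simp: A_def perturbed_epigraph_def nth_append intro!: exI[of _ k])
    then have "(0, - a) + (h, t + norm h / real (Suc k)) \<in> E" unfolding E_def
      by (blast intro: hull_inc)
    then have "blinfun_apply x' h \<le> t + norm h / real (Suc k) - a" using x'(2) by simp
    then show ?thesis by (simp add: f(2) real)
  qed (use f(1) in auto)
  then have "subgrad_on UNIV f x x'" unfolding subgrad_on_iff_radii using R by blast
  with x'(1) show thesis by (rule that)
qed

lemma not_descends_below_if_subgradient_bound:
  fixes f :: "'a::real_normed_vector \<Rightarrow> ereal"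
  assumes a: "f x = ereal a" and y': "norm y' \<le> K"
    and sub: "\<And>k h. k < length rs \<Longrightarrow> h \<in> Y \<Longrightarrow> norm h < rs ! k \<Longrightarrow>
      f x + ereal (blinfun_apply y' h - norm h / real (Suc k)) \<le> f (x + h)"
  shows "\<not> descends_below K a (perturbed_epigraph f rs x \<inter> Y \<times> UNIV)"
proof -
  have "perturbed_epigraph f rs x \<inter> Y \<times> UNIV \<subseteq> epigraph UNIV (\<lambda>h. a + blinfun_apply y' h)"
  proof clarify
    fix h s assume "(h, s) \<in> perturbed_epigraph f rs x" "h \<in> Y"
    then obtain k where "k < length rs" "norm h < rs ! k"
      and s: "f (x + h) + ereal (norm h / real (Suc k)) \<le> ereal s"
      by (auto simp: perturbed_epigraph_def)
    then have "ereal (a + blinfun_apply y' h - norm h / real (Suc k)) \<le> f (x + h)"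
      using sub[of k h] \<open>h \<in> Y\<close> by (simp add: a add_diff_eq)
    with s show "(h, s) \<in> epigraph UNIV (\<lambda>h. a + blinfun_apply y' h)"
      by (cases "f (x + h)") (auto simp: mem_epigraph)
  qed
  moreover have "convex (epigraph UNIV (\<lambda>h. a + blinfun_apply y' h))"
    by (intro convex_epigraphI convex_onI)
      (auto simp: blinfun.add_right blinfun.diff_right blinfun.scaleR_right algebra_simps)
  ultimately have hull: "convex hull (perturbed_epigraph f rs x \<inter> Y \<times> UNIV)
      \<subseteq> epigraph UNIV (\<lambda>h. a + blinfun_apply y' h)"
    by (rule hull_minimal)
  have "a \<le> s + K * norm h" if "(h, s) \<in> convex hull (perturbed_epigraph f rs x \<inter> Y \<times> UNIV)" for h s
    using subsetD[OF hull that] abs_blinfun_le[OF y', of h] by (simp add: mem_epigraph abs_le_iff)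
  then show ?thesis by (fastforce simp: descends_below_def not_less[symmetric])
qed

lemma rational_radii_exist:
  fixes \<gamma> :: real
  assumes \<gamma>: "0 < \<gamma>" and R: "\<And>k. 0 < R k"
  obtains \<mu> rs where "0 < \<mu>" "\<mu> \<le> \<gamma>" "rs \<in> lists \<rat>" "length rs = n"
    "\<forall>k<n. R k / 2 + \<mu> \<le> rs ! k \<and> rs ! k + \<mu> \<le> R k"
proof -
  define \<mu> where "\<mu> = Min (insert \<gamma> ((\<lambda>k. R k / 8) ` {..<n}))"
  have \<mu>: "0 < \<mu>" "\<mu> \<le> \<gamma>" using R \<gamma> by (auto simp: \<mu>_def)
  have \<mu>_le: "\<mu> \<le> R k / 8" if "k < n" for k
    unfolding \<mu>_def using that by (intro Min_le) auto
  have "\<exists>\<rho>\<in>\<rat>. 5 / 8 * R k < \<rho> \<and> \<rho> < 7 / 8 * R k" for k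
    using Rats_dense_in_real[of "5 / 8 * R k" "7 / 8 * R k"] R[of k] by auto
  then obtain \<rho> where \<rho>: "\<And>k. \<rho> k \<in> \<rat>" "\<And>k. 5 / 8 * R k < \<rho> k" "\<And>k. \<rho> k < 7 / 8 * R k" by metis
  have "R k / 2 + \<mu> \<le> \<rho> k \<and> \<rho> k + \<mu> \<le> R k" if "k < n" for k
    using \<mu>_le[OF that] \<rho>(2,3)[of k] by simp
  then show thesis using \<mu> \<rho>(1) by (intro that[of \<mu> "map \<rho> [0..<n]"]) auto
qed

text \<open>A descent configuration at \<open>x\<close> is moved to a nearby point \<open>v\<close> of \<open>C\<close>, replaced there by one
  inside the subspace, and moved back, where it contradicts the subgradient along the subspace.\<close>

lemma not_descends_below_if_descent_rich:
  fixes f :: "'a::real_normed_vector \<Rightarrow> ereal"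
  assumes Y: "subspace (closure C)" and rich: "descent_rich f K C" and K: "0 \<le> K"
    and x: "x \<in> closure C" "f x = ereal a" and y': "norm y' \<le> K" and R: "\<And>k. 0 < R k"
    and sub: "\<And>k h. h \<in> closure C \<Longrightarrow> norm h < R k \<Longrightarrow>
      f x + ereal (blinfun_apply y' h - norm h / real (Suc k)) \<le> f (x + h)"
  shows "\<not> descends_below K a (perturbed_epigraph f (map (\<lambda>k. R k / 2) [0..<n]) x)"
proof
  assume "descends_below K a (perturbed_epigraph f (map (\<lambda>k. R k / 2) [0..<n]) x)"
  then obtain h s
    where hs: "(h, s) \<in> convex hull perturbed_epigraph f (map (\<lambda>k. R k / 2) [0..<n]) x"
      "s + K * norm h < a"
    by (auto simp: descends_below_def)
  obtain \<beta> where \<beta>: "\<beta> \<in> \<rat>" "s + K * norm h < \<beta>" "\<beta> < a" using Rats_dense_in_real[OF hs(2)] by blast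
  define \<gamma> where "\<gamma> = min (\<beta> - (s + K * norm h)) (a - \<beta>) / 2"
  have \<gamma>: "0 < \<gamma>" "\<gamma> < \<beta> - (s + K * norm h)" "\<gamma> < a - \<beta>"
    using \<beta>(2,3) by (auto simp: \<gamma>_def min_def)
  then have "0 < \<gamma> / (1 + K)" using K by simp
  then obtain \<mu> rs where \<mu>: "0 < \<mu>" "\<mu> \<le> \<gamma> / (1 + K)" and rs: "rs \<in> lists \<rat>" "length rs = n"
    and radii: "\<forall>k<n. R k / 2 + \<mu> \<le> rs ! k \<and> rs ! k + \<mu> \<le> R k"
    by (rule rational_radii_exist[OF _ R])
  have "(1 + K) * \<mu> \<le> \<gamma>" using \<mu>(2) K by (simp add: pos_le_divide_eq mult.commute)
  then have \<mu>_small: "s + K * norm h < \<beta> - (1 + K) * \<mu>" "\<beta> + (1 + K) * \<mu> < a"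
    using \<gamma>(2,3) by linarith+
  obtain v where v: "v \<in> C" "norm (x - v) < \<mu>"
    using x(1) \<mu>(1) by (metis closure_approachable dist_norm norm_minus_commute)
  have "descends_below K (\<beta> - (1 + K) * \<mu>)
      (perturbed_epigraph f (map (\<lambda>k. R k / 2) [0..<n]) x \<inter> UNIV \<times> UNIV)"
    using hs(1) \<mu>_small(1) by (auto simp: descends_below_def)
  from descends_below_translate[OF subspace_UNIV this UNIV_I less_imp_le[OF v(2)] K, of rs]
  have "descends_below K \<beta> (perturbed_epigraph f rs v)" using rs(2) radii by simp
  then have "descends_below K \<beta> (perturbed_epigraph f rs v \<inter> C \<times> UNIV)"
    using rich v(1) rs(1) \<beta>(1) unfolding descent_rich_def by blast
  then have "descends_below K \<beta> (perturbed_epigraph f rs v \<inter> closure C \<times> UNIV)"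
    by (rule descends_below_mono) (use closure_subset in blast)
  moreover have "v - x \<in> closure C" using subspace_diff[OF Y _ x(1)] v(1) closure_subset by blast
  moreover have "norm (v - x) \<le> \<mu>" using v(2) by (simp add: norm_minus_commute)
  ultimately have "descends_below K (\<beta> + (1 + K) * \<mu>)
      (perturbed_epigraph f (map R [0..<n]) (v - (v - x)) \<inter> closure C \<times> UNIV)"
    by (rule descends_below_translate[OF Y]) (use K rs(2) radii in auto)
  moreover have "\<not> descends_below K a (perturbed_epigraph f (map R [0..<n]) x \<inter> closure C \<times> UNIV)"
    by (rule not_descends_below_if_subgradient_bound[of f x, OF x(2) y']) (use sub in auto)
  ultimately show False using \<mu>_small(2) by (force simp: descends_below_def)
qed

lemma separable_reduction:
  fixes f :: "'a::real_normed_vector \<Rightarrow> ereal"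
  assumes f: "\<And>x. f x \<noteq> -\<infinity>" and K: "0 \<le> K"
  obtains C where "countable C" "x0 \<in> C" "subspace (closure C)"
    "\<forall>x y'. x \<in> closure C \<longrightarrow> f x \<noteq> \<infinity> \<longrightarrow> norm y' \<le> K \<longrightarrow> subgrad_on (closure C) f x y' \<longrightarrow>
      (\<exists>x'. norm x' \<le> K \<and> subgrad_on UNIV f x x')"
proof -
  obtain C where C: "countable C" "x0 \<in> C" "subspace (closure C)" and rich: "descent_rich f K C"
    by (rule descent_rich_set_exists)
  show thesis
  proof (rule that[OF C], intro allI impI)
    fix x y' assume x: "x \<in> closure C" "f x \<noteq> \<infinity>" and y': "norm y' \<le> K" "subgrad_on (closure C) f x y'"
    obtain a where a: "f x = ereal a" using x(2) f[of x] by (cases "f x") auto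
    obtain R where R: "\<forall>k. 0 < R k \<and> (\<forall>h\<in>closure C. norm h < R k \<longrightarrow>
        f x + ereal (blinfun_apply y' h - norm h / real (Suc k)) \<le> f (x + h))"
      using y'(2)[unfolded subgrad_on_iff_radii] by (rule exE)
    then have no_descent:
      "\<not> descends_below K a (perturbed_epigraph f (map (\<lambda>k. R k / 2) [0..<n]) x)" for n
      by (intro not_descends_below_if_descent_rich[OF C(3) rich K x(1) a y'(1)]) auto
    have R_pos: "0 < R k / 2" for k using R by simp
    obtain x' where "norm x' \<le> K" "subgrad_on UNIV f x x'"
      by (rule subgradient_if_not_descends_below[where f = f and x = x, OF f a K R_pos no_descent])
    then show "\<exists>x'. norm x' \<le> K \<and> subgrad_on UNIV f x x'" by blast
  qed
qed

section \<open>Subgradients at perturbed minima\<close>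

definition real_epigraph :: "('a \<Rightarrow> ereal) \<Rightarrow> ('a \<times> real) set" where
  "real_epigraph f = {(x, t). f x \<le> ereal t}"

definition effective_domain :: "('a \<Rightarrow> ereal) \<Rightarrow> 'a set" where
  "effective_domain f = {x. f x \<noteq> \<infinity>}"

definition finite_part :: "('a \<Rightarrow> ereal) \<Rightarrow> 'a \<Rightarrow> real" where
  "finite_part f x = real_of_ereal (f x)"

lemma ereal_finite_part: "f x \<noteq> -\<infinity> \<Longrightarrow> x \<in> effective_domain f \<Longrightarrow> ereal (finite_part f x) = f x"
  by (cases "f x") (auto simp: effective_domain_def finite_part_def)

lemma epigraph_finite_part:
  assumes "\<And>x. f x \<noteq> -\<infinity>"
  shows "epigraph (Y \<inter> effective_domain f) (finite_part f) = real_epigraph f \<inter> Y \<times> UNIV"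
proof -
  have "x \<in> effective_domain f \<and> finite_part f x \<le> t \<longleftrightarrow> f x \<le> ereal t" for x t
    using assms[of x] by (cases "f x") (auto simp: effective_domain_def finite_part_def)
  then show ?thesis by (auto simp: epigraph_def real_epigraph_def)
qed

lemma real_epigraph_max_0: "real_epigraph (\<lambda>x. max (f x) 0) = real_epigraph f \<inter> UNIV \<times> {0..}"
  by (auto simp: real_epigraph_def)

lemma lsc_eventually_greater:
  assumes "lsc f" "M < f x"
  shows "\<forall>\<^sub>F y in nhds x. M < f y"
proof -
  have "M < Liminf (at x) f" using assms by (auto simp: lsc_def intro: less_le_trans)
  then have "\<forall>\<^sub>F y in at x. M < f y" by (rule less_LiminfD)
  then show ?thesis using assms(2) by (auto simp: eventually_at_filter elim: eventually_mono)
qed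

lemma closed_real_epigraph:
  fixes f :: "'a::topological_space \<Rightarrow> ereal"
  assumes "lsc f"
  shows "closed (real_epigraph f)"
  unfolding closed_def
proof (subst open_subopen, intro ballI)
  fix p assume "p \<in> - real_epigraph f"
  then obtain x t where p: "p = (x, t)" "ereal t < f x"
    by (cases p) (auto simp: real_epigraph_def not_le)
  obtain m where m: "ereal t < ereal m" "ereal m < f x" using ereal_dense2[OF p(2)] by blast
  obtain U where U: "open U" "x \<in> U" "\<forall>y\<in>U. ereal m < f y"
    using lsc_eventually_greater[OF assms m(2)] by (auto simp: eventually_nhds)
  have "\<not> f y \<le> ereal b" if "y \<in> U" "b < m" for y b
    using U(3) that by (metis less_ereal.simps(1) order.strict_trans not_le)
  then have "U \<times> {..<m} \<subseteq> - real_epigraph f" by (auto simp: real_epigraph_def)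
  then show "\<exists>T. open T \<and> p \<in> T \<and> T \<subseteq> - real_epigraph f"
    using U(1,2) p(1) m(1) by (intro exI[of _ "U \<times> {..<m}"]) (auto intro: open_Times)
qed

lemma convex_real_epigraph:
  assumes "ext_convex f"
  shows "convex (real_epigraph f)"
  unfolding convex_alt
proof (intro ballI allI impI)
  fix p q and t :: real assume pq: "p \<in> real_epigraph f" "q \<in> real_epigraph f" and t: "0 \<le> t \<and> t \<le> 1"
  have "f ((1 - t) *\<^sub>R fst p + t *\<^sub>R fst q) \<le> ereal (1 - t) * f (fst p) + ereal t * f (fst q)"
    using assms t unfolding ext_convex_def by blast
  also have "\<dots> \<le> ereal (1 - t) * ereal (snd p) + ereal t * ereal (snd q)"
    using pq t by (intro add_mono ereal_mult_left_mono) (auto simp: real_epigraph_def)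
  finally show "(1 - t) *\<^sub>R p + t *\<^sub>R q \<in> real_epigraph f"
    by (simp add: real_epigraph_def case_prod_beta)
qed

lemma convex_perturbed_minimum_subgradient:
  fixes F :: "'a::real_normed_vector \<Rightarrow> real"
  assumes F: "convex_on S F" and R: "c-lipschitz_on UNIV R"
    and min: "is_arg_min (\<lambda>u. F u + R u) (\<lambda>u. u \<in> S) l"
  obtains x' where "norm x' \<le> c" "\<forall>u\<in>S. F l + blinfun_apply x' (u - l) \<le> F u"
proof -
  define E where "E = (+) (- l, - F l) ` epigraph S F"
  have "convex E" unfolding E_def using F by (intro convex_translation convex_epigraphI)
  moreover have "0 \<le> s + c * norm h" if hs: "(h, s) \<in> E" for h s
  proof -
    obtain e where "e \<in> epigraph S F" "(h, s) = (- l, - F l) + e"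
      using hs unfolding E_def by blast
    then have "fst e \<in> S" "F (fst e) \<le> snd e" "h = fst e - l" "s = snd e - F l"
      by (auto simp: epigraph_def prod_eq_iff)
    moreover from this(1) have "F l + R l \<le> F (fst e) + R (fst e)" using min
      by (simp add: is_arg_min_linorder)
    ultimately show ?thesis using lipschitz_on_diff_le[OF R, of "fst e" l] by simp
  qed
  ultimately obtain x' where x': "norm x' \<le> c" "\<And>h s. (h, s) \<in> E \<Longrightarrow> blinfun_apply x' h \<le> s"
    using hahn_banach_convex[OF _ lipschitz_on_nonneg[OF R]] by blast
  have "F l + blinfun_apply x' (u - l) \<le> F u" if "u \<in> S" for u
  proof -
    have "(u - l, F u - F l) \<in> E"
      unfolding E_def by (rule image_eqI[of _ _ "(u, F u)"]) (use that in \<open>auto simp: mem_epigraph\<close>)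
    then show ?thesis using x'(2) by force
  qed
  with x'(1) show thesis by (intro that) auto
qed

lemma subgrad_on_perturbed_minimum:
  fixes f :: "'a::real_normed_vector \<Rightarrow> ereal"
  assumes f: "\<And>x. f x \<noteq> -\<infinity>" and Y: "subspace Y"
    and min: "is_arg_min (\<lambda>u. finite_part f u + R u) (\<lambda>u. u \<in> Y \<inter> effective_domain f) l"
    and \<xi>: "supergrad_on Y R l \<xi>"
  shows "subgrad_on Y f l (- \<xi>)"
  unfolding subgrad_on_def
proof (intro allI impI)
  have l: "l \<in> Y \<inter> effective_domain f" using min by (simp add: is_arg_min_linorder)
  fix r :: real assume "0 < r"
  with \<xi> have "\<forall>\<^sub>F h in at 0 within Y. h \<in> Y \<and> R (l + h) \<le> R l + blinfun_apply \<xi> h + r * norm h"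
    unfolding supergrad_on_def by (simp add: eventually_conj_iff eventually_at_filter)
  then show "\<forall>\<^sub>F h in at 0 within Y. f l + ereal (blinfun_apply (- \<xi>) h - r * norm h) \<le> f (l + h)"
  proof eventually_elim
    case (elim h)
    show ?case
    proof (cases "l + h \<in> effective_domain f")
      case True
      then have "finite_part f l + R l \<le> finite_part f (l + h) + R (l + h)"
        using min elim l subspace_add[OF Y, of l h] by (simp add: is_arg_min_linorder)
      then show ?thesis using elim l True
        by (simp add: blinfun.minus_left flip: ereal_finite_part[of f, OF f])
    qed (simp add: effective_domain_def)
  qed
qed

lemma supergrad_on_gauge_suminf:
  assumes Y: "subspace Y" and z: "z \<in> Y" "\<And>n. x n \<in> Y" and a: "summable a"
    and W: "\<And>n. (a n)-lipschitz_on UNIV (W n)" "\<And>n. \<forall>z\<in>Y. \<exists>\<xi>. norm \<xi> \<le> a n \<and> supergrad_on Y (W n) z \<xi>"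
    and sum: "\<And>z. summable (\<lambda>n. W n (z - x n))"
  obtains \<xi> where "norm \<xi> \<le> suminf a" "supergrad_on Y (gauge_suminf W x) z \<xi>"
proof -
  have "\<exists>\<xi>. norm \<xi> \<le> a n \<and> supergrad_on Y (W n) (z - x n) \<xi>" for n
    using W(2)[of n] subspace_diff[OF Y z(1) z(2)[of n]] by blast
  then obtain \<xi> where \<xi>: "\<And>n. norm (\<xi> n) \<le> a n" "\<And>n. supergrad_on Y (W n) (z - x n) (\<xi> n)" by metis
  have norm_summable: "summable (\<lambda>n. norm (\<xi> n))"
    by (rule summable_comparison_test'[OF a]) (simp add: \<xi>(1))
  show thesis
  proof (rule that)
    show "norm (suminf \<xi>) \<le> suminf a"
      using summable_norm[OF norm_summable] suminf_le[OF \<xi>(1) norm_summable a] by linarith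
    show "supergrad_on Y (gauge_suminf W x) z (suminf \<xi>)"
      unfolding gauge_suminf_def[abs_def]
      by (intro supergrad_on_suminf[OF lipschitz_on_shift[OF W(1)] a sum \<xi>(1)]
          supergrad_on_shift \<xi>(2))
  qed
qed

lemma lipschitz_on_gauge_suminf:
  assumes "\<And>n. (a n)-lipschitz_on UNIV (W n)" "summable a" "\<And>z. summable (\<lambda>n. W n (z - x n))"
  shows "(suminf a)-lipschitz_on UNIV (gauge_suminf W x)"
  unfolding gauge_suminf_def[abs_def] by (intro lipschitz_on_suminf lipschitz_on_shift assms)

lemma gauge_variational_principle_ereal:
  fixes f :: "'a::banach \<Rightarrow> ereal" and V :: "real \<Rightarrow> real \<Rightarrow> 'a \<Rightarrow> real"
  assumes f: "\<And>x. 0 \<le> f x" and closed: "closed (real_epigraph f)" "closed Y"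
    and x0: "x0 \<in> Y" "f x0 < ereal (\<kappa> * \<rho>)" and \<rho>: "0 < \<rho>"
    and V: "\<And>a s. 0 < a \<Longrightarrow> 0 < s \<Longrightarrow> norm_gauge a s (V a s)"
  obtains a s x l where "\<forall>n. 0 < a n" "\<forall>n. 0 < s n" "summable a" "suminf a < \<kappa>"
    "\<forall>n. x n \<in> Y" "\<forall>z. summable (\<lambda>n. V (a n) (s n) (z - x n))"
    "is_arg_min (\<lambda>u. finite_part f u + gauge_suminf (\<lambda>n. V (a n) (s n)) x u)
      (\<lambda>u. u \<in> Y \<inter> effective_domain f) l"
    "f l < ereal (\<kappa> * (\<rho> - norm (l - x0)))"
proof -
  have f_bot: "f x \<noteq> -\<infinity>" for x using f[of x] by auto
  note f_eq = ereal_finite_part[of f, OF f_bot]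
  have closed_epigraph: "closed (epigraph (Y \<inter> effective_domain f) (finite_part f))"
    unfolding epigraph_finite_part[OF f_bot] by (intro closed_Int closed closed_Times closed_UNIV)
  have x0_in: "x0 \<in> Y \<inter> effective_domain f" using x0 by (auto simp: effective_domain_def)
  have nonneg: "0 \<le> finite_part f u" for u using f[of u]
    by (simp add: finite_part_def real_of_ereal_pos)
  have less: "finite_part f x0 < \<kappa> * \<rho>"
    using x0(2) x0_in f_eq[of x0] by (simp flip: less_ereal.simps(1))
  obtain a s x l where pos: "\<forall>n. 0 < a n" "\<forall>n. 0 < s n" and a: "summable a" "suminf a < \<kappa>"
    and x: "\<forall>n. x n \<in> Y \<inter> effective_domain f" and sum: "\<forall>z. summable (\<lambda>n. V (a n) (s n) (z - x n))"
    and min: "is_arg_min (\<lambda>u. finite_part f u + gauge_suminf (\<lambda>n. V (a n) (s n)) x u)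
      (\<lambda>u. u \<in> Y \<inter> effective_domain f) l"
    and l_less: "finite_part f l < \<kappa> * (\<rho> - norm (l - x0))"
    by (rule gauge_variational_principle[OF closed_epigraph nonneg x0_in less \<rho> V])
  have "l \<in> effective_domain f" using min by (simp add: is_arg_min_linorder)
  then have "f l < ereal (\<kappa> * (\<rho> - norm (l - x0)))"
    using l_less f_eq[of l] by (simp flip: less_ereal.simps(1))
  moreover have "\<forall>n. x n \<in> Y" using x by blast
  ultimately show thesis by (intro that[OF pos a _ sum min])
qed

lemma asplund_approximate_subgradient:
  fixes f :: "'a::banach \<Rightarrow> ereal"
  assumes asplund: "asplund TYPE('a)" and f: "\<And>x. 0 \<le> f x" and closed: "closed (real_epigraph f)"
    and x0: "f x0 < ereal (\<kappa> * \<rho>)" and \<rho>: "0 < \<rho>" and \<kappa>: "0 < \<kappa>"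
  obtains x x' where "subgrad_on UNIV f x x'" "norm x' \<le> \<kappa>" "f x < ereal (\<kappa> * (\<rho> - norm (x - x0)))"
proof -
  have f_bot: "f x \<noteq> -\<infinity>" for x using f[of x] by auto
  obtain C where C: "countable C" "x0 \<in> C" and Y: "subspace (closure C)"
    and extend: "\<forall>x y'. x \<in> closure C \<longrightarrow> f x \<noteq> \<infinity> \<longrightarrow> norm y' \<le> \<kappa> \<longrightarrow> subgrad_on (closure C) f x y' \<longrightarrow>
      (\<exists>x'. norm x' \<le> \<kappa> \<and> subgrad_on UNIV f x x')"
    by (rule separable_reduction[where f = f and K = \<kappa>, OF f_bot less_imp_le[OF \<kappa>]])
  have "\<exists>W. norm_gauge a s W \<and> (\<forall>z\<in>closure C. \<exists>\<xi>. norm \<xi> \<le> a \<and> supergrad_on (closure C) W z \<xi>)"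
    if as: "0 < a" "0 < s" for a s
    by (rule asplund_smooth_gauge[OF asplund Y order.refl C(1) closure_subset as]) blast
  then obtain V where V: "\<And>a s. 0 < a \<Longrightarrow> 0 < s \<Longrightarrow> norm_gauge a s (V a s)"
    and V_super: "\<And>a s. 0 < a \<Longrightarrow> 0 < s \<Longrightarrow>
      \<forall>z\<in>closure C. \<exists>\<xi>. norm \<xi> \<le> a \<and> supergrad_on (closure C) (V a s) z \<xi>"
    by metis
  have "x0 \<in> closure C" using C(2) closure_subset by blast
  then obtain a s x l where pos: "\<forall>n. 0 < a n" "\<forall>n. 0 < s n" and a: "summable a" "suminf a < \<kappa>"
    and x: "\<forall>n. x n \<in> closure C" and sum: "\<forall>z. summable (\<lambda>n. V (a n) (s n) (z - x n))"
    and min: "is_arg_min (\<lambda>u. finite_part f u + gauge_suminf (\<lambda>n. V (a n) (s n)) x u)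
      (\<lambda>u. u \<in> closure C \<inter> effective_domain f) l"
    and l_less: "f l < ereal (\<kappa> * (\<rho> - norm (l - x0)))"
    by (rule gauge_variational_principle_ereal[OF f closed closed_closure _ x0 \<rho> V])
  have l: "l \<in> closure C" "f l \<noteq> \<infinity>" using min
    by (simp_all add: is_arg_min_linorder effective_domain_def)
  obtain \<xi> where \<xi>: "norm \<xi> \<le> suminf a"
    "supergrad_on (closure C) (gauge_suminf (\<lambda>n. V (a n) (s n)) x) l \<xi>"
    by (rule supergrad_on_gauge_suminf[OF Y l(1) spec[OF x] a(1), where W = "\<lambda>n. V (a n) (s n)"])
      (use pos V_super sum norm_gauge_lipschitz[OF V] in auto)
  have "subgrad_on (closure C) f l (- \<xi>)"
    by (rule subgrad_on_perturbed_minimum[OF f_bot Y min \<xi>(2)])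
  moreover have "norm (- \<xi>) \<le> \<kappa>" using \<xi>(1) a(2) by simp
  ultimately obtain x' where "norm x' \<le> \<kappa>" "subgrad_on UNIV f l x'" using extend l by blast
  then show thesis using l_less that by blast
qed

lemma norm_gauge_norm:
  assumes "0 < a" "0 < s"
  shows "norm_gauge a s (\<lambda>z::'a::real_normed_vector. a * norm z)"
proof -
  have "dist (a * norm x) (a * norm y) \<le> a * dist x y" for x y :: 'a
    using mult_left_mono[OF norm_triangle_ineq3[of x y], of a] assms
    by (simp add: dist_real_def dist_norm abs_mult flip: right_diff_distrib)
  then show ?thesis using assms by (auto simp: norm_gauge_def lipschitz_on_def)
qed

lemma convex_approximate_subgradient:
  fixes f :: "'a::banach \<Rightarrow> ereal"
  assumes convex: "convex (real_epigraph f)" and f: "\<And>x. 0 \<le> f x"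
    and closed: "closed (real_epigraph f)"
    and x0: "f x0 < ereal (\<kappa> * \<rho>)" and \<rho>: "0 < \<rho>"
  obtains x x' where "subgrad_on UNIV f x x'" "norm x' \<le> \<kappa>" "f x < ereal (\<kappa> * (\<rho> - norm (x - x0)))"
proof -
  have f_bot: "f x \<noteq> -\<infinity>" for x using f[of x] by auto
  obtain a s :: "nat \<Rightarrow> real" and x l where a_pos: "\<forall>n. 0 < a n" and "\<forall>n. 0 < s n"
    and a: "summable a" "suminf a < \<kappa>" and "\<forall>n. x n \<in> (UNIV :: 'a set)"
    and sum: "\<forall>z. summable (\<lambda>n. a n * norm (z - x n))"
    and min: "is_arg_min (\<lambda>u. finite_part f u + gauge_suminf (\<lambda>n z. a n * norm z) x u)
      (\<lambda>u. u \<in> UNIV \<inter> effective_domain f) l"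
    and l_less: "f l < ereal (\<kappa> * (\<rho> - norm (l - x0)))"
    by (rule gauge_variational_principle_ereal[OF f closed closed_UNIV UNIV_I x0 \<rho> norm_gauge_norm])
  have "(a n)-lipschitz_on UNIV (\<lambda>z::'a. a n * norm z)" for n
    using norm_gauge_lipschitz[OF norm_gauge_norm[OF spec[OF a_pos] zero_less_one]] .
  then have "(suminf a)-lipschitz_on UNIV (gauge_suminf (\<lambda>n z. a n * norm z) x)"
    using a(1) sum by (intro lipschitz_on_gauge_suminf) auto
  moreover have "convex_on (UNIV \<inter> effective_domain f) (finite_part f)"
    unfolding convex_epigraph[symmetric] epigraph_finite_part[OF f_bot] using convex by simp
  ultimately obtain x' where x': "norm x' \<le> suminf a"
    and le: "\<forall>u\<in>UNIV \<inter> effective_domain f.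
      finite_part f l + blinfun_apply x' (u - l) \<le> finite_part f u"
    using convex_perturbed_minimum_subgradient[OF _ _ min] by metis
  have l: "l \<in> effective_domain f" using min by (simp add: is_arg_min_linorder)
  have "f l + ereal (blinfun_apply x' h - r * norm h) \<le> f (l + h)" if "0 < r" for r h
  proof (cases "l + h \<in> effective_domain f")
    case True
    then have "finite_part f l + blinfun_apply x' h \<le> finite_part f (l + h)" using le by force
    moreover have "0 \<le> r * norm h" using that by simp
    ultimately show ?thesis using l True by (simp flip: ereal_finite_part[of f, OF f_bot])
  qed (simp add: effective_domain_def)
  then have "subgrad_on UNIV f l x'" by (simp add: subgrad_on_def)
  then show thesis using order.trans[OF x' less_imp_le[OF a(2)]] l_less by (rule that)
qed

lemma approximate_subgradient:
  fixes f :: "'a::banach \<Rightarrow> ereal"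
  assumes "asplund TYPE('a) \<or> convex (real_epigraph f)" and "\<And>x. 0 \<le> f x" "closed (real_epigraph f)"
    and "f x0 < ereal (\<kappa> * \<rho>)" "0 < \<rho>" "0 < \<kappa>"
  obtains x x' where "subgrad_on UNIV f x x'" "norm x' \<le> \<kappa>" "f x < ereal (\<kappa> * (\<rho> - norm (x - x0)))"
  using assms(1)
proof
  assume "asplund TYPE('a)"
  then show thesis by (rule asplund_approximate_subgradient[OF _ assms(2-)]) (rule that)
next
  assume "convex (real_epigraph f)"
  then show thesis by (rule convex_approximate_subgradient[OF _ assms(2-5)]) (rule that)
qed

lemma subgrad_on_transfer:
  assumes "subgrad_on Y g x x'" "g x = f x" "\<forall>\<^sub>F h in at 0 within Y. g (x + h) \<le> f (x + h)"
  shows "subgrad_on Y f x x'"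
  unfolding subgrad_on_def
proof (intro allI impI)
  fix r :: real assume "0 < r"
  with assms(1) have "\<forall>\<^sub>F h in at 0 within Y.
      g x + ereal (blinfun_apply x' h - r * norm h) \<le> g (x + h)"
    by (simp add: subgrad_on_def)
  with assms(3) show "\<forall>\<^sub>F h in at 0 within Y.
      f x + ereal (blinfun_apply x' h - r * norm h) \<le> f (x + h)"
    by eventually_elim (use assms(2) in \<open>simp add: order.trans\<close>)
qed

lemma subgrad_on_UNIV_imp_frechet_subdiff:
  fixes f :: "'a::real_normed_vector \<Rightarrow> ereal"
  assumes sub: "subgrad_on UNIV f x x'" and x: "f x = ereal a"
  shows "x' \<in> frechet_subdiff f x"
proof -
  have "\<forall>\<^sub>F y in at x. M < (f y - f x - ereal (blinfun_apply x' (y - x))) / ereal (norm (y - x))"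
    if M: "M < 0" for M
  proof -
    obtain r where r: "M < ereal r" "ereal r < 0" using ereal_dense2[OF M] by auto
    then have "0 < - r" by simp
    then have "\<forall>\<^sub>F h in at 0. f x + ereal (blinfun_apply x' h - (- r) * norm h) \<le> f (x + h)"
      using sub unfolding subgrad_on_def by blast
    then have "\<forall>\<^sub>F h in at 0. h \<noteq> 0 \<and> f x + ereal (blinfun_apply x' h - (- r) * norm h) \<le> f (x + h)"
      by (simp add: eventually_conj_iff eventually_neq_at_within)
    then have "\<forall>\<^sub>F y in at x. y \<noteq> x \<and>
        f x + ereal (blinfun_apply x' (y - x) - (- r) * norm (y - x)) \<le> f y"
      unfolding eventually_at_to_0[of _ x] by (simp add: add.commute)
    then show ?thesis
    proof eventually_elim
      case (elim y)
      have "ereal r \<le> (f y - f x - ereal (blinfun_apply x' (y - x))) / ereal (norm (y - x))"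
        using elim by (cases "f y") (auto simp: x field_simps)
      with r(1) show ?case by simp
    qed
  qed
  then show ?thesis by (simp add: frechet_subdiff_def le_Liminf_iff x)
qed

text \<open>Away from \<open>[f \<le> 0]\<close> the functions \<open>f\<close> and \<open>f\<^sub>+\<close> agree locally, and \<open>f\<^sub>+\<close> is bounded below.\<close>

lemma frechet_subgradient_near_positive_point:
  fixes f :: "'a::banach \<Rightarrow> ereal"
  assumes f: "lsc f" and space: "asplund TYPE('a) \<or> ext_convex f"
    and pos: "\<And>u. norm (u - x0) < \<rho> \<Longrightarrow> 0 < f u" and x0: "f x0 < ereal (\<kappa> * \<rho>)" and \<rho>: "0 < \<rho>"
  obtains x x' where "x' \<in> frechet_subdiff f x" "norm x' < \<kappa>" "0 < f x"
    "f x < ereal (\<kappa> * (\<rho> - norm (x - x0)))"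
proof -
  define g where "g x = max (f x) 0" for x
  have "0 < f x0" using pos \<rho> by simp
  then obtain M where M: "f x0 = ereal M" "0 < M" using x0 by (cases "f x0") auto
  then have "M / \<rho> < \<kappa>" using x0 \<rho> by (simp add: pos_divide_less_eq)
  then obtain c where c: "M / \<rho> < c" "c < \<kappa>" using dense by blast
  have c_pos: "0 < c" using c(1) M(2) \<rho> by (meson divide_pos_pos order.strict_trans)
  have g_x0: "g x0 < ereal (c * \<rho>)" using c(1) M \<rho> by (simp add: g_def max_def pos_divide_less_eq)
  have g_nonneg: "0 \<le> g x" for x by (simp add: g_def)
  have closed: "closed (real_epigraph g)"
    unfolding g_def[abs_def] real_epigraph_max_0
    by (intro closed_Int closed_real_epigraph[OF f] closed_Times closed_UNIV closed_atLeast)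
  have "convex (real_epigraph g)" if "ext_convex f"
    unfolding g_def[abs_def] real_epigraph_max_0
    by (intro convex_Int convex_real_epigraph that convex_Times convex_UNIV convex_real_interval)
  then have "asplund TYPE('a) \<or> convex (real_epigraph g)" using space by blast
  then obtain x x' where sub: "subgrad_on UNIV g x x'" and x': "norm x' \<le> c"
    and x: "g x < ereal (c * (\<rho> - norm (x - x0)))"
    by (rule approximate_subgradient[OF _ g_nonneg closed g_x0 \<rho> c_pos])
  have "0 < c * (\<rho> - norm (x - x0))" using le_less_trans[OF g_nonneg x] by simp
  then have near: "norm (x - x0) < \<rho>" using c_pos by (simp add: zero_less_mult_iff)
  then have f_x: "0 < f x" by (rule pos)
  then have g_x: "g x = f x" by (simp add: g_def max_absorb1 less_imp_le)
  have "\<forall>\<^sub>F y in nhds x. 0 < f y" by (rule lsc_eventually_greater[OF f f_x])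
  then have "\<forall>\<^sub>F y in at x. g y \<le> f y"
    by (auto simp: eventually_at_filter g_def elim: eventually_mono)
  then have "subgrad_on UNIV f x x'"
    by (intro subgrad_on_transfer[where g = g and f = f, OF sub g_x])
      (simp add: eventually_at_to_0[of _ x] add.commute)
  moreover obtain a where "f x = ereal a" using f_x x g_x by (cases "f x") auto
  ultimately have "x' \<in> frechet_subdiff f x" by (rule subgrad_on_UNIV_imp_frechet_subdiff)
  moreover have "c * (\<rho> - norm (x - x0)) \<le> \<kappa> * (\<rho> - norm (x - x0))"
    using c(2) near by (intro mult_right_mono) auto
  ultimately show thesis
    using that x' c(2) f_x x unfolding g_x by (metis ereal_less_eq(3) le_less_trans less_le_trans)
qed

section \<open>The error bound\<close>

lemma edist_set_eq_infdist:
  assumes "A \<noteq> {}"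
  shows "edist_set x A = ereal (infdist x A)"
proof -
  obtain a where a: "a \<in> A" using assms by blast
  have "(INF a\<in>A. ereal (dist x a)) \<le> ereal (dist x a)" by (rule INF_lower[OF a])
  moreover have "0 \<le> (INF a\<in>A. ereal (dist x a))" by (intro INF_greatest) simp
  ultimately have "\<bar>INF a\<in>A. ereal (dist x a)\<bar> \<noteq> \<infinity>" by auto
  from ereal_INF[OF this] show ?thesis using assms by (simp add: edist_set_def infdist_def)
qed

lemma epow_ereal: "0 < t \<Longrightarrow> epow (ereal t) p = ereal (t powr p)"
  by (simp add: epow_def)

lemma epow_le_powr:
  assumes "0 \<le> t" "t \<le> ereal b" "0 < p"
  shows "epow t p \<le> ereal (b powr p)"
  using assms by (cases t) (auto simp: epow_def intro: powr_mono2)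

lemma powr_le_epow:
  assumes "0 \<le> b" "ereal b \<le> t" "0 < p"
  shows "ereal (b powr p) \<le> epow t p"
  using assms by (cases t) (auto simp: epow_def intro: powr_mono2)

lemma dist_subdiff_nonneg: "0 \<le> dist_subdiff f x"
  unfolding dist_subdiff_def by (intro INF_greatest) simp

lemma dist_subdiff_le: "x' \<in> frechet_subdiff f x \<Longrightarrow> dist_subdiff f x \<le> ereal (norm x')"
  unfolding dist_subdiff_def by (rule INF_lower)

lemma subgradient_violates_slope_condition:
  assumes q: "0 < q" and D: "0 < D" and bound: "\<kappa> powr q * D powr (q - 1) \<le> \<tau>"
    and x': "x' \<in> frechet_subdiff f x" "norm x' < \<kappa>" and x: "0 < f x" "f x < ereal (\<kappa> * D)"
  shows "epow (f x) q < ereal (\<tau> * D)"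
    and "epow (ereal D) (q - 1) * epow (dist_subdiff f x) q < ereal \<tau>"
proof -
  have \<kappa>: "0 < \<kappa>" using x'(2) norm_ge_zero[of x'] by linarith
  obtain b where b: "f x = ereal b" "0 < b" "b < \<kappa> * D" using x by (cases "f x") auto
  have "b powr q < (\<kappa> * D) powr q" using b(2,3) q by (intro powr_less_mono2) auto
  also have "\<dots> = \<kappa> powr q * D powr (q - 1) * D" using \<kappa> D by (simp add: powr_mult powr_diff)
  also have "\<dots> \<le> \<tau> * D" using bound D by (intro mult_right_mono) auto
  finally show "epow (f x) q < ereal (\<tau> * D)" using b(1,2) by (simp add: epow_ereal)
  have "epow (ereal D) (q - 1) * epow (dist_subdiff f x) q
      \<le> ereal (D powr (q - 1)) * ereal (norm x' powr q)"
    unfolding epow_ereal[OF D] using dist_subdiff_le[OF x'(1)] dist_subdiff_nonneg q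
    by (intro ereal_mult_left_mono epow_le_powr) auto
  also have "\<dots> < ereal (D powr (q - 1) * \<kappa> powr q)"
    using x'(2) q D by (simp add: powr_less_mono2)
  also have "\<dots> \<le> ereal \<tau>" using bound by (simp add: mult.commute)
  finally show "epow (ereal D) (q - 1) * epow (dist_subdiff f x) q < ereal \<tau>" .
qed

lemma slope_condition_imp_ge:
  fixes f :: "'a::banach \<Rightarrow> ereal"
  assumes f: "lsc f" "asplund TYPE('a) \<or> ext_convex f" and S: "S = {y. f y \<le> 0}"
    and \<tau>: "0 < \<tau>" and q: "0 < q" "q \<le> 1" and \<alpha>: "0 < \<alpha>" "\<alpha> < 1" and d: "0 < infdist x S"
    and \<kappa>: "0 < \<kappa>" "\<kappa> powr q \<le> \<tau> * ((1 - \<alpha>) * infdist x S) powr (1 - q)"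
    and slope: "\<And>u. dist x u < \<alpha> * infdist x S \<Longrightarrow> 0 < f u \<Longrightarrow> epow (f u) q < ereal (\<tau> * infdist u S) \<Longrightarrow>
      ereal \<tau> \<le> epow (ereal (infdist u S)) (q - 1) * epow (dist_subdiff f u) q"
  shows "ereal (\<kappa> * (\<alpha> * infdist x S)) \<le> f x"
proof (rule ccontr)
  define d where "d = infdist x S"
  have \<alpha>_d: "0 < \<alpha> * d" "\<alpha> * d < d" using \<alpha> d by (simp_all add: d_def)
  assume "\<not> ?thesis"
  then have f_x: "f x < ereal (\<kappa> * (\<alpha> * d))" by (simp add: d_def not_le)
  have far: "d - norm (u - x) \<le> infdist u S" for u
    using infdist_triangle[of x S u] by (simp add: d_def dist_norm norm_minus_commute)
  have "0 < f u" if "norm (u - x) < \<alpha> * d" for u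
  proof -
    have "infdist u S \<noteq> 0" using far[of u] that \<alpha>_d by linarith
    then have "u \<notin> S" using infdist_zero[of u S] by blast
    then show ?thesis by (simp add: S not_le)
  qed
  then obtain u u' where u': "u' \<in> frechet_subdiff f u" "norm u' < \<kappa>"
    and f_u: "0 < f u" "f u < ereal (\<kappa> * (\<alpha> * d - norm (u - x)))"
    by (rule frechet_subgradient_near_positive_point[OF f _ f_x \<alpha>_d(1)])
  have near: "norm (u - x) < \<alpha> * d"
    using order.strict_trans[OF f_u] \<kappa>(1) by (simp add: zero_less_mult_iff)
  define D where "D = infdist u S"
  have D: "(1 - \<alpha>) * d \<le> D" "\<alpha> * d - norm (u - x) \<le> D" "0 < D"
    using far[of u] near \<alpha>_d by (simp_all add: D_def algebra_simps)
  have "\<kappa> powr q \<le> \<tau> * D powr (1 - q)"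
    using D(1) \<alpha> d q \<tau> unfolding d_def
    by (intro order.trans[OF \<kappa>(2)] mult_left_mono powr_mono2) auto
  then have "\<kappa> powr q * D powr (q - 1) \<le> \<tau> * D powr (1 - q) * D powr (q - 1)"
    by (rule mult_right_mono) simp
  then have "\<kappa> powr q * D powr (q - 1) \<le> \<tau>"
    using D(3) by (simp add: mult.assoc flip: powr_add)
  moreover have "f u < ereal (\<kappa> * D)"
    using f_u(2) by (rule less_le_trans) (use D(2) \<kappa>(1) in simp)
  ultimately have "epow (f u) q < ereal (\<tau> * D)"
    "epow (ereal D) (q - 1) * epow (dist_subdiff f u) q < ereal \<tau>"
    using subgradient_violates_slope_condition[OF q(1) D(3) _ u' f_u(1)] by blast+
  then show False
    using slope[of u] near f_u(1) by (simp add: D_def d_def dist_norm norm_minus_commute)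
qed

text \<open>Within \<open>\<alpha> * d\<close> of \<open>x\<close> the distance to \<open>[f \<le> 0]\<close> exceeds \<open>(1 - \<alpha>) * d\<close>, which dictates \<open>\<kappa>\<close>.\<close>

lemma slope_condition_imp_error_bound:
  fixes f :: "'a::banach \<Rightarrow> ereal"
  assumes f: "lsc f" "asplund TYPE('a) \<or> ext_convex f" and S: "S = {y. f y \<le> 0}"
    and \<tau>: "0 < \<tau>" and q: "0 < q" "q \<le> 1" and \<alpha>: "0 < \<alpha>" "\<alpha> < 1"
    and slope: "\<And>u. dist x u < \<alpha> * infdist x S \<Longrightarrow> 0 < f u \<Longrightarrow> epow (f u) q < ereal (\<tau> * infdist u S) \<Longrightarrow>
      ereal \<tau> \<le> epow (ereal (infdist u S)) (q - 1) * epow (dist_subdiff f u) q"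
  shows "ereal (\<alpha> powr q * (1 - \<alpha>) powr (1 - q) * \<tau> * infdist x S) \<le> epow (max (f x) 0) q"
proof (cases "infdist x S = 0")
  case True
  then show ?thesis by (simp add: epow_def)
next
  case False
  define d where "d = infdist x S"
  have d: "0 < d" using False infdist_nonneg[of x S] by (simp add: d_def)
  define \<kappa> where "\<kappa> = (\<tau> * ((1 - \<alpha>) * d) powr (1 - q)) powr (1 / q)"
  have \<kappa>: "0 < \<kappa>" "\<kappa> powr q = \<tau> * ((1 - \<alpha>) * d) powr (1 - q)"
    using q \<tau> \<alpha> d by (simp_all add: \<kappa>_def powr_powr)
  have "ereal (\<kappa> * (\<alpha> * d)) \<le> f x"
    using d \<kappa> unfolding d_def
    by (intro slope_condition_imp_ge[OF f S \<tau> q \<alpha>] slope) simp_all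
  then have "ereal (\<kappa> * (\<alpha> * d)) \<le> max (f x) 0" by (simp add: le_max_iff_disj)
  then have "ereal ((\<kappa> * (\<alpha> * d)) powr q) \<le> epow (max (f x) 0) q"
    using \<kappa> \<alpha> d q by (intro powr_le_epow) auto
  moreover have "d powr (1 - q) * d powr q = d" using d by (simp flip: powr_add)
  then have "(\<kappa> * (\<alpha> * d)) powr q = \<alpha> powr q * (1 - \<alpha>) powr (1 - q) * \<tau> * d"
    using \<kappa> \<alpha> d by (simp add: powr_mult)
  ultimately show ?thesis by (simp only: d_def)
qed

lemma eball_divide_subset:
  assumes x: "x \<in> eball c (\<delta> / ereal (1 + \<alpha>))" and \<alpha>: "0 < \<alpha>" and u: "dist x u \<le> \<alpha> * dist c x"
  shows "u \<in> eball c \<delta>"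
proof -
  have "ereal (dist c u) \<le> ereal ((1 + \<alpha>) * dist c x)"
    using dist_triangle[of c u x] u by (simp add: distrib_right)
  also have "ereal ((1 + \<alpha>) * dist c x) < \<delta>"
    using x \<alpha> by (cases \<delta>) (auto simp: eball_def field_simps)
  finally show ?thesis by (simp add: eball_def)
qed

theorem theorem3p11:
  fixes f :: "'a::banach \<Rightarrow> ereal"
    and xbar :: 'a and \<tau> q :: real and \<delta> :: ereal
  assumes f_proper_range: "\<forall>x. f x \<noteq> -\<infinity>"
    and f_lsc: "lsc f"
    and xbar_in: "f xbar \<le> 0"
    and tau_pos: "\<tau> > 0"
    and delta_pos: "\<delta> > 0"
    and q_range: "0 < q" "q \<le> 1"
    and asplund_or_convex: "asplund TYPE('a) \<or> ext_convex f"
    and slope_cond: "\<forall>x \<in> eball xbar \<delta> \<inter> {x. f x > 0}.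
        epow (f x) q < ereal \<tau> * edist_set x {y. f y \<le> 0} \<longrightarrow>
        epow (edist_set x {y. f y \<le> 0}) (q - 1) * epow (dist_subdiff f x) q \<ge> ereal \<tau>"
  shows "\<forall>\<alpha>. 0 < \<alpha> \<and> \<alpha> < 1 \<longrightarrow> (\<forall>x \<in> eball xbar (\<delta> / ereal (1 + \<alpha>)).
           ereal (\<alpha> powr q * (1 - \<alpha>) powr (1 - q) * \<tau>) * edist_set x {y. f y \<le> 0}
             \<le> epow (max (f x) 0) q)"
proof (intro allI impI ballI)
  fix \<alpha> :: real and x
  assume \<alpha>: "0 < \<alpha> \<and> \<alpha> < 1" and x: "x \<in> eball xbar (\<delta> / ereal (1 + \<alpha>))"
  define S where "S = {y. f y \<le> 0}"
  have xbar: "xbar \<in> S" using xbar_in by (simp add: S_def)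
  then have S: "S \<noteq> {}" by blast
  have in_ball: "u \<in> eball xbar \<delta>" if u: "dist x u < \<alpha> * infdist x S" for u
  proof -
    have "\<alpha> * infdist x S \<le> \<alpha> * dist xbar x"
      using infdist_le[OF xbar, of x] \<alpha> by (intro mult_left_mono) (auto simp: dist_commute)
    with u have "dist x u \<le> \<alpha> * dist xbar x" by linarith
    then show ?thesis using eball_divide_subset[OF x] \<alpha> by blast
  qed
  have "ereal (\<alpha> powr q * (1 - \<alpha>) powr (1 - q) * \<tau> * infdist x S) \<le> epow (max (f x) 0) q"
    using \<alpha> slope_cond in_ball edist_set_eq_infdist[OF S]
    by (intro slope_condition_imp_error_bound[OF f_lsc asplund_or_convex S_def tau_pos q_range])
      (auto simp flip: S_def)
  then show "ereal (\<alpha> powr q * (1 - \<alpha>) powr (1 - q) * \<tau>) * edist_set x {y. f y \<le> 0}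
      \<le> epow (max (f x) 0) q"
    using edist_set_eq_infdist[OF S] by (simp add: S_def)
qed

end
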